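(* Let $X$ be a Banach lattice. Then the uo-dual $X_{uo}^\sim$ is the order continuous part of the order continuous dual $X_n^\sim$, i.e. $X_{uo}^\sim=(X_n^\sim)^a$. Specifically, for any $\phi\in X_n^\sim$, the following statements are equivalent: (1) $\phi\in X_{uo}^\sim$; (2) $\phi(x_n)\to 0$ for any norm bounded uo-null sequence $(x_n)$ in $X$; (3) $\phi(x_n)\to 0$ for any norm bounded disjoint sequence $(x_n)$ in $X$; (4) every disjoint sequence in $[0,|\phi|]$ is norm null.
   Context: A net $(x_\alpha)$ in a vector lattice $X$ order converges to $x\in X$ ($x_\alpha\xrightarrow{o}x$) if there is a net $(y_\gamma)$ in $X$ (possibly with a different index set) with $y_\gamma\downarrow 0$ such that for every $\gamma$ there is $\alpha_0$ with $|x_\alpha-x|\le y_\gamma$ for all $\alpha\ge\alpha_0$. The net uo-converges to $x$ ($x_\alpha\xrightarrow{uo}x$) if $|x_\alpha-x|\wedge y\xrightarrow{o}0$ for every $y\in X_+$; it is uo-null if it uo-converges to $0$. For a Banach lattice $X$, the order continuous dual $X_n^\sim$ is the set of all linear functionals $\phi$ on $X$ with $\phi(x_\alpha)\to0$ whenever $x_\alpha\xrightarrow{o}0$; it is a band in the norm dual $X^*$. The uo-dual $X_{uo}^\sim$ is the set of all linear functionals $\phi$ on $X$ with $\phi(x_\alpha)\to 0$ for every norm bounded uo-null net $(x_\alpha)$ in $X$ (such functionals are called boundedly uo-continuous). The order continuous part of a Banach lattice $Z$ is $Z^a=\{z\in Z:\text{every disjoint sequence in }[0,|z|]\text{ is norm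 null}\}$; it is the largest norm closed ideal of $Z$ that is order continuous in its own right. The interval $[0,|\phi|]$ is the same whether taken in $X_n^\sim$ or in $X^*$. *)

theory Defs
  imports "HOL-Analysis.Analysis" "HOL-Library.Lattice_Algebras"
begin

class banach_lattice = banach + ordered_real_vector + lattice_ab_group_add_abs +
  assumes norm_mono_abs: "\<bar>x\<bar> \<le> \<bar>y\<bar> \<Longrightarrow> norm x \<le> norm y"

instance real :: banach_lattice
  by standard auto


text \<open>A net is a function \<open>x :: 'i \<Rightarrow> 'a\<close> considered on an index set \<open>I :: 'i set\<close>, which is
  directed by a (not necessarily antisymmetric) preorder \<open>le\<close>. Sequences are the nets with
  index set \<open>UNIV :: nat set\<close> and preorder \<open>(\<le>)\<close>.\<close>

definition directed_set :: "'i set \<Rightarrow> ('i \<Rightarrow> 'i \<Rightarrow> bool) \<Rightarrow> bool" where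
  "directed_set I le \<longleftrightarrow>
     I \<noteq> {} \<and> (\<forall>a\<in>I. le a a) \<and>
     (\<forall>a\<in>I. \<forall>b\<in>I. \<forall>c\<in>I. le a b \<longrightarrow> le b c \<longrightarrow> le a c) \<and>
     (\<forall>a\<in>I. \<forall>b\<in>I. \<exists>c\<in>I. le a c \<and> le b c)"

lemma directed_set_nat: "directed_set (UNIV :: nat set) (\<le>)"
  unfolding directed_set_def by (auto intro: max.cobounded1 max.cobounded2)

definition net_filter :: "'i set \<Rightarrow> ('i \<Rightarrow> 'i \<Rightarrow> bool) \<Rightarrow> 'i filter" where
  "net_filter I le = (INF a\<in>I. principal {b \<in> I. le a b})"

lemma eventually_net_filter:
  assumes "directed_set I le"
  shows "eventually P (net_filter I le) \<longleftrightarrow> (\<exists>a\<in>I. \<forall>b\<in>I. le a b \<longrightarrow> P b)"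
proof -
  have "eventually P (net_filter I le) \<longleftrightarrow> (\<exists>a\<in>I. eventually P (principal {b \<in> I. le a b}))"
    unfolding net_filter_def
  proof (rule eventually_INF_base)
    show "I \<noteq> {}" using assms by (simp add: directed_set_def)
  next
    fix a b assume ab: "a \<in> I" "b \<in> I"
    then obtain c where "c \<in> I" "le a c" "le b c"
      using assms unfolding directed_set_def by meson
    moreover from this ab have "{d \<in> I. le c d} \<subseteq> {d \<in> I. le a d} \<inter> {d \<in> I. le b d}"
      using assms unfolding directed_set_def by blast
    ultimately show "\<exists>x\<in>I. principal {b \<in> I. le x b} \<le>
        inf (principal {b \<in> I. le a b}) (principal {d \<in> I. le b d})"
      by auto
  qed
  then show ?thesis by (auto simp: eventually_principal)
qed

lemma net_filter_nat: "net_filter UNIV (\<le>) = sequentially"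
  by (simp add: net_filter_def at_top_def atLeast_def)

definition decreases_to_zero :: "'j set \<Rightarrow> ('j \<Rightarrow> 'j \<Rightarrow> bool) \<Rightarrow> ('j \<Rightarrow> 'a::banach_lattice) \<Rightarrow> bool" where
  "decreases_to_zero J le y \<longleftrightarrow>
     (\<forall>a\<in>J. \<forall>b\<in>J. le a b \<longrightarrow> y b \<le> y a) \<and>
     (\<forall>a\<in>J. 0 \<le> y a) \<and> (\<forall>z. (\<forall>a\<in>J. z \<le> y a) \<longrightarrow> z \<le> 0)"

text \<open>HOL cannot quantify over index types inside a definition. The dominating net is
  therefore indexed by a subset of \<open>'a\<close>; the lemma \<open>order_convergesI\<close> below shows that
  dominating nets of arbitrary index type give the same notion.\<close>

definition order_converges ::
    "'i set \<Rightarrow> ('i \<Rightarrow> 'i \<Rightarrow> bool) \<Rightarrow> ('i \<Rightarrow> 'a::banach_lattice) \<Rightarrow> 'a \<Rightarrow> bool" where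
  "order_converges I le x l \<longleftrightarrow>
     (\<exists>(J::'a set) leJ y. directed_set J leJ \<and> decreases_to_zero J leJ y \<and>
        (\<forall>c\<in>J. \<exists>a0\<in>I. \<forall>a\<in>I. le a0 a \<longrightarrow> \<bar>x a - l\<bar> \<le> y c))"

lemma order_convergesI:
  fixes x :: "'i \<Rightarrow> 'a::banach_lattice" and y :: "'j \<Rightarrow> 'a"
  assumes dir: "directed_set J leJ" and dec: "decreases_to_zero J leJ y"
    and dom: "\<And>c. c \<in> J \<Longrightarrow> \<exists>a0\<in>I. \<forall>a\<in>I. le a0 a \<longrightarrow> \<bar>x a - l\<bar> \<le> y c"
  shows "order_converges I le x l"
  unfolding order_converges_def
proof (intro exI conjI)
  have dd: "\<exists>w\<in>y ` J. w \<le> u \<and> w \<le> v" if uv: "u \<in> y ` J" "v \<in> y ` J" for u v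
  proof -
    from uv obtain a b where ab: "a \<in> J" "b \<in> J" "u = y a" "v = y b" by auto
    then obtain c where c: "c \<in> J" "leJ a c" "leJ b c"
      using dir unfolding directed_set_def by meson
    then have "y c \<le> u" "y c \<le> v"
      using ab dec unfolding decreases_to_zero_def by blast+
    then show ?thesis using c(1) by blast
  qed
  have "y ` J \<noteq> {}" using dir by (simp add: directed_set_def)
  then show "directed_set (y ` J) (\<lambda>u v. v \<le> u)"
    unfolding directed_set_def using dd by (blast intro: order_refl dest: order_trans)
  show "decreases_to_zero (y ` J) (\<lambda>u v. v \<le> u) id"
    using dec unfolding decreases_to_zero_def by auto
  show "\<forall>c\<in>y ` J. \<exists>a0\<in>I. \<forall>a\<in>I. le a0 a \<longrightarrow> \<bar>x a - l\<bar> \<le> id c"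
    using dom by auto
qed

definition uo_converges ::
    "'i set \<Rightarrow> ('i \<Rightarrow> 'i \<Rightarrow> bool) \<Rightarrow> ('i \<Rightarrow> 'a::banach_lattice) \<Rightarrow> 'a \<Rightarrow> bool" where
  "uo_converges I le x l \<longleftrightarrow> (\<forall>y\<ge>0. order_converges I le (\<lambda>a. inf \<bar>x a - l\<bar> y) 0)"

definition norm_bounded_net :: "'i set \<Rightarrow> ('i \<Rightarrow> 'a::banach_lattice) \<Rightarrow> bool" where
  "norm_bounded_net I x \<longleftrightarrow> bounded (x ` I)"

definition disjoint_sequence :: "(nat \<Rightarrow> 'a::banach_lattice) \<Rightarrow> bool" where
  "disjoint_sequence x \<longleftrightarrow> (\<forall>m n. m \<noteq> n \<longrightarrow> inf \<bar>x m\<bar> \<bar>x n\<bar> = 0)"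


text \<open>Again the index type has to be fixed. It is \<open>'a \<times> 'a set\<close>, which is large enough because
  every net is determined, as far as convergence is concerned, by the pairs of a value and a tail
  containing it; see \<open>order_cont_dualD\<close> and \<open>uo_dualD\<close> for nets of arbitrary index type.\<close>

definition order_cont_dual :: "('a::banach_lattice \<Rightarrow> real) set" where
  "order_cont_dual = {\<phi>. linear \<phi> \<and>
     (\<forall>(I::('a \<times> 'a set) set) le x. directed_set I le \<longrightarrow> order_converges I le x 0 \<longrightarrow>
        ((\<lambda>a. \<phi> (x a)) \<longlongrightarrow> 0) (net_filter I le))}"

definition uo_dual :: "('a::banach_lattice \<Rightarrow> real) set" where
  "uo_dual = {\<phi>. linear \<phi> \<and>
     (\<forall>(I::('a \<times> 'a set) set) le x. directed_set I le \<longrightarrow> norm_bounded_net I x \<longrightarrow>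
        uo_converges I le x 0 \<longrightarrow> ((\<lambda>a. \<phi> (x a)) \<longlongrightarrow> 0) (net_filter I le))}"

definition tail_index :: "'i set \<Rightarrow> ('i \<Rightarrow> 'i \<Rightarrow> bool) \<Rightarrow> ('i \<Rightarrow> 'a) \<Rightarrow> ('a \<times> 'a set) set" where
  "tail_index I le x = {(v, T). v \<in> T \<and> (\<exists>a\<in>I. T = x ` {b \<in> I. le a b})}"

definition tail_le :: "'a \<times> 'a set \<Rightarrow> 'a \<times> 'a set \<Rightarrow> bool" where
  "tail_le p q \<longleftrightarrow> snd q \<subseteq> snd p"

lemma tail_indexI:
  "a \<in> I \<Longrightarrow> b \<in> I \<Longrightarrow> le a b \<Longrightarrow> (x b, x ` {b \<in> I. le a b}) \<in> tail_index I le x"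
  by (auto simp: tail_index_def)

lemma directed_set_tail_index:
  assumes "directed_set I le"
  shows "directed_set (tail_index I le x) tail_le"
proof -
  have ne: "tail_index I le x \<noteq> {}"
    using assms tail_indexI[of _ I _ le x] unfolding directed_set_def by (metis all_not_in_conv)
  have "\<exists>r\<in>tail_index I le x. tail_le p r \<and> tail_le q r"
    if p: "p \<in> tail_index I le x" and q: "q \<in> tail_index I le x" for p q
  proof -
    from p obtain a where a: "a \<in> I" "snd p = x ` {b \<in> I. le a b}" by (auto simp: tail_index_def)
    from q obtain b where b: "b \<in> I" "snd q = x ` {c \<in> I. le b c}" by (auto simp: tail_index_def)
    from a b obtain c where c: "c \<in> I" "le a c" "le b c"
      using assms unfolding directed_set_def by meson
    then have "(x c, x ` {b \<in> I. le c b}) \<in> tail_index I le x"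
      using assms tail_indexI[of c I c le x] by (simp add: directed_set_def)
    moreover have sub: "{d \<in> I. le c d} \<subseteq> {d \<in> I. le a d}" "{d \<in> I. le c d} \<subseteq> {d \<in> I. le b d}"
      using a b c assms unfolding directed_set_def by blast+
    moreover have "tail_le p (x c, x ` {b \<in> I. le c b})" "tail_le q (x c, x ` {b \<in> I. le c b})"
      unfolding tail_le_def snd_conv a(2) b(2) by (rule image_mono, rule sub)+
    ultimately show ?thesis by blast
  qed
  then show ?thesis using ne by (auto simp: directed_set_def tail_le_def)
qed

lemma tail_eventually_iff:
  assumes "directed_set I le"
  shows "(\<exists>p0\<in>tail_index I le x. \<forall>p\<in>tail_index I le x. tail_le p0 p \<longrightarrow> P (fst p)) \<longleftrightarrow>
    (\<exists>a0\<in>I. \<forall>a\<in>I. le a0 a \<longrightarrow> P (x a))"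
proof
  assume "\<exists>p0\<in>tail_index I le x. \<forall>p\<in>tail_index I le x. tail_le p0 p \<longrightarrow> P (fst p)"
  then obtain p0 where p0: "p0 \<in> tail_index I le x"
    "\<And>p. p \<in> tail_index I le x \<Longrightarrow> tail_le p0 p \<Longrightarrow> P (fst p)" by auto
  from p0(1) obtain a0 where a0: "a0 \<in> I" "snd p0 = x ` {b \<in> I. le a0 b}"
    by (auto simp: tail_index_def)
  have "P (x a)" if "a \<in> I" "le a0 a" for a
    using p0(2)[OF tail_indexI[of a0 I a le x]] a0 that by (simp add: tail_le_def)
  with a0 show "\<exists>a0\<in>I. \<forall>a\<in>I. le a0 a \<longrightarrow> P (x a)" by blast
next
  assume "\<exists>a0\<in>I. \<forall>a\<in>I. le a0 a \<longrightarrow> P (x a)"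
  then obtain a0 where a0: "a0 \<in> I" "\<And>a. a \<in> I \<Longrightarrow> le a0 a \<Longrightarrow> P (x a)" by auto
  have "le a0 a0" using assms a0(1) by (simp add: directed_set_def)
  then have "(x a0, x ` {b \<in> I. le a0 b}) \<in> tail_index I le x" by (intro tail_indexI a0(1))
  moreover have "P (fst p)"
    if "p \<in> tail_index I le x" "tail_le (x a0, x ` {b \<in> I. le a0 b}) p" for p
  proof -
    have "fst p \<in> snd p" using that(1) by (auto simp: tail_index_def)
    then show ?thesis using that(2) a0(2) by (auto simp: tail_le_def)
  qed
  ultimately show "\<exists>p0\<in>tail_index I le x. \<forall>p\<in>tail_index I le x. tail_le p0 p \<longrightarrow> P (fst p)" by blast
qed

lemma order_converges_tail_iff:
  fixes x :: "'i \<Rightarrow> 'a::banach_lattice" and f :: "'a \<Rightarrow> 'a"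
  assumes "directed_set I le"
  shows "order_converges (tail_index I le x) tail_le (\<lambda>p. f (fst p)) l \<longleftrightarrow>
    order_converges I le (\<lambda>a. f (x a)) l"
proof -
  have "(\<exists>p0\<in>tail_index I le x. \<forall>p\<in>tail_index I le x. tail_le p0 p \<longrightarrow> \<bar>f (fst p) - l\<bar> \<le> u) \<longleftrightarrow>
      (\<exists>a0\<in>I. \<forall>a\<in>I. le a0 a \<longrightarrow> \<bar>f (x a) - l\<bar> \<le> u)" for u
    by (rule tail_eventually_iff[OF assms, of x "\<lambda>v. \<bar>f v - l\<bar> \<le> u"])
  then show ?thesis unfolding order_converges_def by (simp only:)
qed

lemma tendsto_tail_iff:
  fixes x :: "'i \<Rightarrow> 'a::banach_lattice" and \<phi> :: "'a \<Rightarrow> real"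
  assumes "directed_set I le"
  shows "((\<lambda>p. \<phi> (fst p)) \<longlongrightarrow> 0) (net_filter (tail_index I le x) tail_le) \<longleftrightarrow>
    ((\<lambda>a. \<phi> (x a)) \<longlongrightarrow> 0) (net_filter I le)"
proof -
  have "(\<exists>p0\<in>tail_index I le x. \<forall>p\<in>tail_index I le x. tail_le p0 p \<longrightarrow> dist (\<phi> (fst p)) 0 < e) \<longleftrightarrow>
      (\<exists>a0\<in>I. \<forall>a\<in>I. le a0 a \<longrightarrow> dist (\<phi> (x a)) 0 < e)" for e
    by (rule tail_eventually_iff[OF assms, of x "\<lambda>v. dist (\<phi> v) 0 < e"])
  then show ?thesis
    unfolding tendsto_iff eventually_net_filter[OF assms]
      eventually_net_filter[OF directed_set_tail_index[OF assms]]
    by (simp only:)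
qed

lemma order_cont_dualD:
  fixes x :: "'i \<Rightarrow> 'a::banach_lattice"
  assumes \<phi>: "\<phi> \<in> order_cont_dual" and dir: "directed_set I le" and x: "order_converges I le x 0"
  shows "((\<lambda>a. \<phi> (x a)) \<longlongrightarrow> 0) (net_filter I le)"
proof -
  have "order_converges (tail_index I le x) tail_le fst 0"
    using x order_converges_tail_iff[OF dir, of x "\<lambda>v. v" 0] by simp
  then have "((\<lambda>p. \<phi> (fst p)) \<longlongrightarrow> 0) (net_filter (tail_index I le x) tail_le)"
    using \<phi> directed_set_tail_index[OF dir, of x] unfolding order_cont_dual_def by blast
  then show ?thesis by (simp add: tendsto_tail_iff[OF dir])
qed

lemma uo_dualD:
  fixes x :: "'i \<Rightarrow> 'a::banach_lattice"
  assumes \<phi>: "\<phi> \<in> uo_dual" and dir: "directed_set I le"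
    and bdd: "norm_bounded_net I x" and x: "uo_converges I le x 0"
  shows "((\<lambda>a. \<phi> (x a)) \<longlongrightarrow> 0) (net_filter I le)"
proof -
  have "uo_converges (tail_index I le x) tail_le fst 0"
    using x unfolding uo_converges_def
    by (simp add: order_converges_tail_iff[OF dir, where f = "\<lambda>v. inf \<bar>v\<bar> _"])
  moreover have "norm_bounded_net (tail_index I le x) fst"
    using bdd unfolding norm_bounded_net_def
    by (rule bounded_subset) (auto simp: tail_index_def)
  ultimately have "((\<lambda>p. \<phi> (fst p)) \<longlongrightarrow> 0) (net_filter (tail_index I le x) tail_le)"
    using \<phi> directed_set_tail_index[OF dir, of x] unfolding uo_dual_def by blast
  then show ?thesis by (simp add: tendsto_tail_iff[OF dir])
qed


text \<open>The order on functionals is the dual order (comparison on the positive cone), not the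
  pointwise order that the library puts on functions. Lattice operations are taken inside a given
  space \<open>Z\<close> of functionals, and the norm is the operator norm \<open>onorm\<close>.\<close>

definition functional_le :: "('a::banach_lattice \<Rightarrow> real) \<Rightarrow> ('a \<Rightarrow> real) \<Rightarrow> bool" where
  "functional_le \<phi> \<psi> \<longleftrightarrow> (\<forall>x\<ge>0. \<phi> x \<le> \<psi> x)"

definition is_functional_sup ::
    "('a::banach_lattice \<Rightarrow> real) set \<Rightarrow> ('a \<Rightarrow> real) set \<Rightarrow> ('a \<Rightarrow> real) \<Rightarrow> bool" where
  "is_functional_sup Z S \<mu> \<longleftrightarrow> \<mu> \<in> Z \<and> (\<forall>\<psi>\<in>S. functional_le \<psi> \<mu>) \<and>
     (\<forall>\<nu>\<in>Z. (\<forall>\<psi>\<in>S. functional_le \<psi> \<nu>) \<longrightarrow> functional_le \<mu> \<nu>)"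

definition is_functional_inf ::
    "('a::banach_lattice \<Rightarrow> real) set \<Rightarrow> ('a \<Rightarrow> real) set \<Rightarrow> ('a \<Rightarrow> real) \<Rightarrow> bool" where
  "is_functional_inf Z S \<mu> \<longleftrightarrow> \<mu> \<in> Z \<and> (\<forall>\<psi>\<in>S. functional_le \<mu> \<psi>) \<and>
     (\<forall>\<nu>\<in>Z. (\<forall>\<psi>\<in>S. functional_le \<nu> \<psi>) \<longrightarrow> functional_le \<nu> \<mu>)"

definition functional_abs ::
    "('a::banach_lattice \<Rightarrow> real) set \<Rightarrow> ('a \<Rightarrow> real) \<Rightarrow> ('a \<Rightarrow> real)" where
  "functional_abs Z \<phi> = (THE \<mu>. is_functional_sup Z {\<phi>, \<lambda>x. - \<phi> x} \<mu>)"

lemma functional_le_antisym: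
  assumes "linear \<phi>" "linear \<psi>" "functional_le \<phi> \<psi>" "functional_le \<psi> \<phi>"
  shows "\<phi> = \<psi>"
proof
  fix x :: 'a
  have eq: "\<phi> y = \<psi> y" if "0 \<le> y" for y
    using assms(3,4) that unfolding functional_le_def by (meson order_antisym)
  have "x = pprt x - (- nprt x)" by (simp add: prts[symmetric])
  moreover have "\<phi> (pprt x) = \<psi> (pprt x)" "\<phi> (- nprt x) = \<psi> (- nprt x)"
    by (auto intro!: eq)
  ultimately show "\<phi> x = \<psi> x"
    using linear_diff[OF assms(1)] linear_diff[OF assms(2)] by metis
qed

lemma functional_abs_eqI:
  assumes "\<And>\<psi>. \<psi> \<in> Z \<Longrightarrow> linear \<psi>" and "is_functional_sup Z {\<phi>, \<lambda>x. - \<phi> x} \<mu>"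
  shows "functional_abs Z \<phi> = \<mu>"
  unfolding functional_abs_def
proof (rule the_equality[where P = "is_functional_sup Z {\<phi>, \<lambda>x. - \<phi> x}", OF assms(2)])
  fix \<nu> assume "is_functional_sup Z {\<phi>, \<lambda>x. - \<phi> x} \<nu>"
  with assms(2) have "functional_le \<mu> \<nu>" "functional_le \<nu> \<mu>" "\<mu> \<in> Z" "\<nu> \<in> Z"
    unfolding is_functional_sup_def by blast+
  then show "\<nu> = \<mu>" using assms(1) by (blast intro: functional_le_antisym)
qed

definition functional_interval ::
    "('a::banach_lattice \<Rightarrow> real) set \<Rightarrow> ('a \<Rightarrow> real) \<Rightarrow> ('a \<Rightarrow> real) \<Rightarrow> ('a \<Rightarrow> real) set" where
  "functional_interval Z \<phi> \<psi> = {\<theta> \<in> Z. functional_le \<phi> \<theta> \<and> functional_le \<theta> \<psi>}"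

definition disjoint_functional_sequence ::
    "('a::banach_lattice \<Rightarrow> real) set \<Rightarrow> (nat \<Rightarrow> 'a \<Rightarrow> real) \<Rightarrow> bool" where
  "disjoint_functional_sequence Z \<psi> \<longleftrightarrow>
     (\<forall>m n. m \<noteq> n \<longrightarrow>
        is_functional_inf Z {functional_abs Z (\<psi> m), functional_abs Z (\<psi> n)} (\<lambda>_. 0))"

definition order_cont_part :: "('a::banach_lattice \<Rightarrow> real) set \<Rightarrow> ('a \<Rightarrow> real) set" where
  "order_cont_part Z = {\<phi> \<in> Z. \<forall>\<psi>.
     (\<forall>n. \<psi> n \<in> functional_interval Z (\<lambda>_. 0) (functional_abs Z \<phi>)) \<longrightarrow>
     disjoint_functional_sequence Z \<psi> \<longrightarrow> (\<lambda>n. onorm (\<psi> n)) \<longlonglongrightarrow> 0}"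

end

theory Submission
  imports Defs
begin

text \<open>
  The key condition, for \<open>\<mu> = \<bar>\<phi>\<bar>\<close>, is that for every \<open>e > 0\<close> there is a \<open>u \<ge> 0\<close> with
  \<open>\<mu> ((x - u)\<^sup>+) < e\<close> for all \<open>x \<ge> 0\<close> in a given ball. If it fails, pick \<open>x\<^sub>n\<close> in the ball with
  \<open>\<mu> ((x\<^sub>n - 4\<^sup>n (x\<^sub>0 + \<dots> + x\<^sub>n\<^sub>-\<^sub>1))\<^sup>+) \<ge> e\<close>; subtracting moreover \<open>2\<^sup>-\<^sup>n \<Sum>\<^sub>k 2\<^sup>-\<^sup>k x\<^sub>k\<close> inside the positive part makes
  the sequence disjoint, against (3).
  The condition gives (1), because \<open>\<bar>\<phi> x\<bar> \<le> \<mu> (inf \<bar>x\<bar> u) + \<mu> ((\<bar>x\<bar> - u)\<^sup>+)\<close> and \<open>\<mu>\<close> is order continuous,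
  and it gives (4), because \<open>\<parallel>\<psi>\<^sub>n\<parallel> \<le> \<psi>\<^sub>n u + e\<close>, while disjointness forces \<open>\<Sum>\<^sub>n \<psi>\<^sub>n u \<le> \<mu> u\<close>.
  Since disjoint sequences are uo-null, (1) implies (2) implies (3). Finally, (4) implies (3): the
  components \<open>\<psi>\<^sub>n y = sup\<^sub>k \<mu> (inf y (k \<bar>x\<^sub>n\<bar>))\<close> of \<open>\<mu>\<close> on the bands generated by disjoint \<open>x\<^sub>n\<close> are disjoint,
  and \<open>\<bar>\<phi> x\<^sub>n\<bar> \<le> \<mu> \<bar>x\<^sub>n\<bar> = \<psi>\<^sub>n \<bar>x\<^sub>n\<bar>\<close>.
\<close>

section \<open>Vector and Banach lattices\<close>

lemma pprt_minus_pprt_uminus: "pprt x - pprt (- x) = (x :: 'a::lattice_ab_group_add)"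
  by (simp add: pprt_neg prts[symmetric])

lemma abs_eq_pprt_add_pprt: "\<bar>x\<bar> = pprt x + pprt (- x)" for x :: "'a::lattice_ab_group_add_abs"
  by (simp add: abs_prts pprt_neg)

lemma pprt_le_abs: "pprt x \<le> \<bar>x\<bar>" for x :: "'a::lattice_ab_group_add_abs"
  by (simp add: abs_eq_pprt_add_pprt)

lemma abs_leI_lattice: "x \<le> a \<Longrightarrow> - x \<le> a \<Longrightarrow> \<bar>x\<bar> \<le> a" for x :: "'a::lattice_ab_group_add_abs"
  by (simp add: abs_lattice)

text \<open>Because \<open>a - inf a b = sup 0 (a - b)\<close>. This cuts \<open>a\<close> at the
  level \<open>b\<close> into a truncation and an excess, the splitting on which the estimates of
  functionals rest.\<close>

lemma inf_add_pprt_diff: "inf a b + pprt (a - b) = a" for a :: "'a::lattice_ab_group_add"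
proof -
  have "a - inf a b = pprt (a - b)"
    by (simp add: pprt_def diff_inf_eq_sup add_sup_distrib_left sup_commute)
  then show ?thesis by (metis add.commute diff_add_cancel)
qed

lemma inf_pprt_pprt_uminus: "inf (pprt x) (pprt (- x)) = (0 :: 'a::lattice_ab_group_add)"
proof -
  have "inf (pprt x) (pprt (- x)) + pprt (pprt x - pprt (- x)) = pprt x"
    by (rule inf_add_pprt_diff)
  then show ?thesis by (simp add: pprt_minus_pprt_uminus)
qed

lemma pprt_diff_ge: "0 \<le> b \<Longrightarrow> pprt a \<le> pprt (a - b) + b" for a :: "'a::lattice_ab_group_add"
  by (simp add: pprt_def add_sup_distrib_right le_supI2)

text \<open>Subtracting \<open>b\<close> from the left side leaves at most \<open>inf a c\<close>.
  Hence subtracting \<open>inf a c\<close> leaves at most \<open>b\<close>, and clearly at most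
  \<open>c\<close>.\<close>

lemma inf_add_le_inf_add_inf:
  fixes a b c :: "'a::lattice_ab_group_add"
  assumes "0 \<le> a" "0 \<le> b" "0 \<le> c"
  shows "inf (a + b) c \<le> inf a c + inf b c"
proof -
  have "inf (a + b) c - b \<le> inf a c"
    using assms by (auto simp: diff_le_eq intro: le_infI1 order_trans[OF inf_le2])
  then have "inf (a + b) c - inf a c \<le> b" by (metis diff_le_eq add.commute)
  moreover have "inf (a + b) c - inf a c \<le> c"
    unfolding diff_le_eq using assms by (intro order_trans[OF inf_le2]) simp
  ultimately have "inf (a + b) c - inf a c \<le> inf b c" by simp
  then show ?thesis by (metis diff_le_eq add.commute)
qed

lemma add_le_if_disjoint:
  fixes a b u :: "'a::lattice_ab_group_add"
  assumes "inf a b = 0" "a \<le> u" "b \<le> u"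
  shows "a + b \<le> u"
  using assms by (simp add: add_eq_inf_sup[of a b])

text \<open>The first summand is \<open>y\<close> clipped to the interval from \<open>- a\<close> to
  \<open>a\<close>. The formula is explicit because the clippings of one fixed \<open>y\<close> by
  the members of a decreasing net later form a net themselves.\<close>

lemma riesz_decomposition:
  fixes y a b :: "'a::lattice_ab_group_add_abs"
  assumes "0 \<le> a" "0 \<le> b" "\<bar>y\<bar> \<le> a + b"
  shows "\<bar>sup (inf y a) (- a)\<bar> \<le> a" "\<bar>y - sup (inf y a) (- a)\<bar> \<le> b"
proof -
  have a: "- a \<le> a" using assms(1) by (simp add: minus_le_self_iff)
  have y: "y \<le> a + b" "- y \<le> a + b"
    using assms(3) by (auto simp: abs_le_iff)
  show "\<bar>sup (inf y a) (- a)\<bar> \<le> a"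
    using a by (intro abs_leI_lattice) (auto simp: minus_le_iff le_supI2)
  have "y - b \<le> sup (inf y a) (- a)"
  proof -
    have "y - b \<le> inf y a" using y(1) assms(2) by (simp add: diff_le_eq order_trans[OF y(1)])
    then show ?thesis by (rule le_supI1)
  qed
  moreover have "sup (inf y a) (- a) \<le> y + b"
  proof -
    have "- a \<le> y + b" using add_right_mono[OF y(2), of "y - a"] by (simp add: add.commute)
    then show ?thesis using assms(2) by (auto simp: le_infI1 intro: order_trans[OF inf_le1])
  qed
  ultimately show "\<bar>y - sup (inf y a) (- a)\<bar> \<le> b"
    by (intro abs_leI_lattice) (simp_all only: diff_le_eq minus_diff_eq add.commute)
qed

section \<open>Norm, scalars and order in a Banach lattice\<close>

lemma norm_abs [simp]: "norm \<bar>x\<bar> = norm x" for x :: "'a::banach_lattice"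
  by (intro order_antisym norm_mono_abs) auto

lemma norm_mono_nonneg: "0 \<le> x \<Longrightarrow> x \<le> y \<Longrightarrow> norm x \<le> norm y" for x y :: "'a::banach_lattice"
  by (intro norm_mono_abs) (simp add: abs_of_nonneg order_trans[of 0 x y])

lemma scaleR_sup_distrib:
  fixes x y :: "'a::banach_lattice"
  assumes "0 < c"
  shows "c *\<^sub>R sup x y = sup (c *\<^sub>R x) (c *\<^sub>R y)"
proof (rule order_antisym)
  have "x \<le> inverse c *\<^sub>R sup (c *\<^sub>R x) (c *\<^sub>R y)" "y \<le> inverse c *\<^sub>R sup (c *\<^sub>R x) (c *\<^sub>R y)"
    using assms by (simp_all add: pos_le_divideR_eq[simplified])
  then have "c *\<^sub>R sup x y \<le> c *\<^sub>R (inverse c *\<^sub>R sup (c *\<^sub>R x) (c *\<^sub>R y))"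
    using assms by (intro scaleR_left_mono) auto
  then show "c *\<^sub>R sup x y \<le> sup (c *\<^sub>R x) (c *\<^sub>R y)" using assms by simp
  show "sup (c *\<^sub>R x) (c *\<^sub>R y) \<le> c *\<^sub>R sup x y"
    using assms by (auto intro!: scaleR_left_mono)
qed

lemma pprt_scaleR: "0 \<le> c \<Longrightarrow> pprt (c *\<^sub>R x) = c *\<^sub>R pprt x" for x :: "'a::banach_lattice"
  by (cases "c = 0") (simp_all add: pprt_def scaleR_sup_distrib)

lemma inf_scaleR_distrib:
  fixes x y :: "'a::banach_lattice"
  assumes "0 < c"
  shows "c *\<^sub>R inf x y = inf (c *\<^sub>R x) (c *\<^sub>R y)"
  using scaleR_sup_distrib[OF assms, of "- x" "- y"]
  unfolding inf_eq_neg_sup scaleR_minus_right by (rule arg_cong)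

lemma abs_scaleR_nonneg: "0 \<le> c \<Longrightarrow> \<bar>c *\<^sub>R x\<bar> = c *\<^sub>R \<bar>x\<bar>" for x :: "'a::banach_lattice"
  using pprt_scaleR[of c x] pprt_scaleR[of c "- x"]
  by (simp add: abs_eq_pprt_add_pprt scaleR_add_right)

text \<open>Positive parts and norms give \<open>real n * norm (pprt w) \<le> norm (pprt y)\<close>
  for every \<open>n\<close>, so \<open>pprt w = 0\<close>.\<close>

lemma banach_lattice_archimedean:
  fixes w y :: "'a::banach_lattice"
  assumes "\<And>n::nat. real n *\<^sub>R w \<le> y"
  shows "w \<le> 0"
proof -
  have "real n * norm (pprt w) \<le> norm (pprt y)" for n
    using norm_mono_nonneg[OF zero_le_pprt pprt_mono[OF assms[of n]]] by (simp add: pprt_scaleR)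
  then have "norm (pprt w) = 0"
    using reals_Archimedean3[of "norm (pprt w)"] by (metis not_le zero_less_norm_iff norm_eq_zero)
  then show ?thesis by (simp add: le_zero_iff_zero_pprt)
qed

text \<open>As soon as \<open>0 \<le> f n\<close>, the negative part \<open>pprt (- l)\<close> of
  the limit lies below \<open>\<bar>f n - l\<bar>\<close>, whose norm tends to
  \<open>0\<close>.\<close>

lemma banach_lattice_nonneg_lim:
  fixes f :: "nat \<Rightarrow> 'a::banach_lattice"
  assumes lim: "f \<longlonglongrightarrow> l" and pos: "eventually (\<lambda>n. 0 \<le> f n) sequentially"
  shows "0 \<le> l"
proof -
  have "eventually (\<lambda>n. norm (pprt (- l)) \<le> norm (f n - l)) sequentially"
    using pos
  proof eventually_elim
    case (elim n)
    then have "pprt (- l) \<le> \<bar>f n - l\<bar>"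
      by (intro order_trans[OF pprt_mono pprt_le_abs]) simp
    from norm_mono_nonneg[OF zero_le_pprt this] show ?case by simp
  qed
  moreover have "(\<lambda>n. norm (f n - l)) \<longlonglongrightarrow> 0" using lim by (simp add: LIM_zero tendsto_norm_zero)
  ultimately have "norm (pprt (- l)) \<le> 0"
    by (intro tendsto_lowerbound) auto
  then show ?thesis by (simp add: pprt_neg zero_le_iff_zero_nprt)
qed

text \<open>The bound \<open>s\<close> is the sum of the absolutely convergent series of all
  \<open>(1/2) ^ n *\<^sub>R x n\<close>, which exists by completeness; closedness of the positive
  cone puts each term below it.\<close>

lemma geometric_domination:
  fixes x :: "nat \<Rightarrow> 'a::banach_lattice"
  assumes pos: "\<And>n. 0 \<le> x n" and bdd: "\<And>n. norm (x n) \<le> M"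
  shows "\<exists>s\<ge>0. \<forall>n. (1/2) ^ n *\<^sub>R x n \<le> s"
proof -
  let ?f = "\<lambda>n. (1/2) ^ n *\<^sub>R x n"
  have "summable ?f"
  proof (rule summable_comparison_test')
    show "summable (\<lambda>n. M * (1/2::real) ^ n)" by (intro summable_mult summable_geometric) simp
    show "norm (?f n) \<le> M * (1/2) ^ n" for n
      using bdd[of n] by (simp add: mult.commute field_simps)
  qed
  then have lim: "(\<lambda>N. \<Sum>i<N. ?f i) \<longlonglongrightarrow> suminf ?f" by (simp add: summable_LIMSEQ)
  have fpos: "0 \<le> ?f n" for n using pos by (simp add: scaleR_nonneg_nonneg)
  have le: "?f n \<le> suminf ?f" for n
  proof -
    have "eventually (\<lambda>N. 0 \<le> (\<Sum>i<N. ?f i) - ?f n) sequentially"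
      using eventually_gt_at_top[of n]
    proof eventually_elim
      case (elim N)
      have "(\<Sum>i<N. ?f i) - ?f n = (\<Sum>i\<in>{..<N} - {n}. ?f i)" using elim by (simp add: sum_diff1)
      also have "\<dots> \<ge> 0" using fpos by (intro sum_nonneg) auto
      finally show ?case .
    qed
    then have "0 \<le> suminf ?f - ?f n"
      by (intro banach_lattice_nonneg_lim[OF tendsto_diff[OF lim tendsto_const]])
    then show ?thesis by simp
  qed
  with fpos show ?thesis by (blast intro: order_trans)
qed

section \<open>Positive and order continuous functionals\<close>

definition positive_functional :: "('a::banach_lattice \<Rightarrow> real) \<Rightarrow> bool" where
  "positive_functional f \<longleftrightarrow> linear f \<and> (\<forall>x\<ge>0. 0 \<le> f x)"

lemma positive_functional_linear: "positive_functional f \<Longrightarrow> linear f"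
  by (simp add: positive_functional_def)

lemma positive_functional_nonneg: "positive_functional f \<Longrightarrow> 0 \<le> x \<Longrightarrow> 0 \<le> f x"
  by (simp add: positive_functional_def)

lemma positive_functional_mono:
  assumes "positive_functional f" "x \<le> y"
  shows "f x \<le> f y"
  using positive_functional_nonneg[OF assms(1), of "y - x"] assms
  by (simp add: linear_diff[OF positive_functional_linear])

lemma abs_positive_functional_le:
  assumes "positive_functional f"
  shows "\<bar>f x\<bar> \<le> f \<bar>x\<bar>"
  using positive_functional_mono[OF assms abs_ge_self, of x]
    positive_functional_mono[OF assms abs_ge_minus_self, of x]
  by (simp add: linear_neg[OF positive_functional_linear[OF assms]])

text \<open>Positive vectors of the unit ball with \<open>4 ^ n < f (x n)\<close> would, scaled by
  \<open>(1/2) ^ n\<close>, all lie below one \<open>s\<close>, forcing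
  \<open>2 ^ n \<le> f s\<close> for every \<open>n\<close>.\<close>

lemma positive_functional_bounded_linear:
  fixes f :: "'a::banach_lattice \<Rightarrow> real"
  assumes f: "positive_functional f"
  shows "bounded_linear f"
proof -
  note lin = positive_functional_linear[OF f]
  have "\<exists>K. \<forall>x\<ge>0. norm x \<le> 1 \<longrightarrow> f x \<le> K"
  proof (rule ccontr)
    assume "\<not> ?thesis"
    then have "\<exists>x\<ge>0. norm x \<le> 1 \<and> 4 ^ n < f x" for n :: nat
      by (metis not_le)
    then have "\<exists>x. \<forall>n. 0 \<le> x n \<and> norm (x n) \<le> 1 \<and> 4 ^ n < f (x n)" by (intro choice) blast
    then obtain x :: "nat \<Rightarrow> 'a"
      where x: "\<And>n. 0 \<le> x n" "\<And>n. norm (x n) \<le> 1" "\<And>n. 4 ^ n < f (x n)" by blast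
    obtain s where "0 \<le> s" and s: "\<And>n. (1/2) ^ n *\<^sub>R x n \<le> s"
      using geometric_domination[of x 1] x(1,2) by blast
    have "2 ^ n \<le> f s" for n
    proof -
      have "(2::real) ^ n = (1/2) ^ n * 4 ^ n" by (simp flip: power_mult_distrib)
      also have "\<dots> \<le> (1/2) ^ n * f (x n)" using x(3)[of n] by (intro mult_left_mono) auto
      also have "\<dots> = f ((1/2) ^ n *\<^sub>R x n)" by (simp add: linear_scale[OF lin])
      also have "\<dots> \<le> f s" by (rule positive_functional_mono[OF f s])
      finally show ?thesis .
    qed
    moreover obtain n where "f s < 2 ^ n" using real_arch_pow[of 2 "f s"] by auto
    ultimately show False by (meson not_le)
  qed
  then obtain K where K: "\<And>x. 0 \<le> x \<Longrightarrow> norm x \<le> 1 \<Longrightarrow> f x \<le> K" by blast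
  show ?thesis
  proof (rule bounded_linear_intro[where K = K])
    show "f (x + y) = f x + f y" for x y by (rule linear_add[OF lin])
    show "f (r *\<^sub>R x) = r *\<^sub>R f x" for r x by (rule linear_scale[OF lin])
    show "norm (f x) \<le> norm x * K" for x
    proof (cases "x = 0")
      case False
      have "f (inverse (norm x) *\<^sub>R \<bar>x\<bar>) \<le> K"
        using False by (intro K) (auto intro: scaleR_nonneg_nonneg)
      then have "f \<bar>x\<bar> \<le> norm x * K"
        using False by (simp add: linear_scale[OF lin] field_simps)
      then show ?thesis using abs_positive_functional_le[OF f, of x] by simp
    qed (simp add: linear_0[OF lin])
  qed
qed

text \<open>Kantorovich's extension: \<open>p\<close> of the positive part minus \<open>p\<close> of
  the negative part. Additivity makes the value independent of how a vector is written as a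
  difference of positive ones. For scalars one inequality is enough, since applying it to
  \<open>inverse c\<close> gives the other.\<close>

lemma positive_functional_extension:
  fixes p :: "'a::banach_lattice \<Rightarrow> real"
  assumes add: "\<And>x y. 0 \<le> x \<Longrightarrow> 0 \<le> y \<Longrightarrow> p (x + y) = p x + p y"
    and scale: "\<And>c x. 0 < c \<Longrightarrow> 0 \<le> x \<Longrightarrow> c * p x \<le> p (c *\<^sub>R x)"
    and pos: "\<And>x. 0 \<le> x \<Longrightarrow> 0 \<le> p x"
  shows "\<exists>f. positive_functional f \<and> (\<forall>x\<ge>0. f x = p x)"
proof -
  define f where "f x = p (pprt x) - p (pprt (- x))" for x
  have f_diff: "f x = p a - p b" if "0 \<le> a" "0 \<le> b" "x = a - b" for x a b
  proof -
    have "a + pprt (- x) = b + pprt x"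
      using that(3) pprt_minus_pprt_uminus[of x] by (simp add: algebra_simps)
    then have "p a + p (pprt (- x)) = p b + p (pprt x)"
      using add[OF that(1) zero_le_pprt[of "- x"]] add[OF that(2) zero_le_pprt[of x]] by simp
    then show ?thesis by (simp add: f_def)
  qed
  have p0: "p 0 = 0" using add[of 0 0] by simp
  have scale_eq: "p (c *\<^sub>R x) = c * p x" if "0 \<le> x" "0 \<le> c" for c x
  proof (cases "c = 0")
    case False
    with that have c: "0 < c" by simp
    have "inverse c * p (c *\<^sub>R x) \<le> p (inverse c *\<^sub>R c *\<^sub>R x)"
      using c that by (intro scale) (auto simp: scaleR_nonneg_nonneg)
    then have "p (c *\<^sub>R x) \<le> c * p x" using c by (simp add: field_simps)
    with scale[OF c that(1)] show ?thesis by simp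
  qed (simp add: p0)
  have f_add: "f (x + y) = f x + f y" for x y
  proof -
    \<comment> \<open>The positive part of a sum is in general not the sum of the positive parts, so
      the independence of the decomposition enters here.\<close>
    have "f (x + y) = p (pprt x + pprt y) - p (pprt (- x) + pprt (- y))"
      by (rule f_diff) (simp_all add: add_diff_add pprt_minus_pprt_uminus del: minus_add_distrib)
    then show ?thesis by (simp add: add f_def)
  qed
  have f_pos_scale: "f (c *\<^sub>R x) = c * f x" if "0 \<le> c" for c x
    using that by (simp add: f_def pprt_scaleR scale_eq right_diff_distrib flip: scaleR_minus_right)
  have f_neg: "f (- x) = - f x" for x by (simp add: f_def)
  have "f (c *\<^sub>R x) = c * f x" for c x
    using f_pos_scale[of c x] f_pos_scale[of "- c" x] f_neg[of "c *\<^sub>R x"] by (cases "0 \<le> c") auto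
  then have "linear f" by (intro linearI) (auto simp: f_add)
  moreover have f_eq: "f x = p x" if "0 \<le> x" for x
    using f_diff[of x 0 x] that p0 by simp
  ultimately have "positive_functional f" using pos by (simp add: positive_functional_def)
  then show ?thesis using f_eq by blast
qed

section \<open>Order continuous functionals\<close>

lemma order_cont_dual_linear: "\<phi> \<in> order_cont_dual \<Longrightarrow> linear \<phi>"
  by (simp add: order_cont_dual_def)

lemma order_cont_dual_diff:
  assumes "\<phi> \<in> order_cont_dual" "\<psi> \<in> order_cont_dual"
  shows "(\<lambda>x. \<phi> x - \<psi> x) \<in> order_cont_dual"
proof -
  have "((\<lambda>a. \<phi> (x a) - \<psi> (x a)) \<longlongrightarrow> 0) (net_filter I le)"
    if "directed_set I le" "order_converges I le x 0" for I :: "('a \<times> 'a set) set" and le x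
    using tendsto_diff[OF order_cont_dualD[OF assms(1) that] order_cont_dualD[OF assms(2) that]] by simp
  then show ?thesis
    using assms by (auto simp: order_cont_dual_def intro: linear_compose_sub)
qed

text \<open>The net is its own dominating net: beyond \<open>c\<close> it stays between
  \<open>0\<close> and \<open>y c\<close>.\<close>

lemma order_cont_dual_decreasing:
  assumes "\<phi> \<in> order_cont_dual" "directed_set J leJ" "decreases_to_zero J leJ y"
  shows "((\<lambda>a. \<phi> (y a)) \<longlongrightarrow> 0) (net_filter J leJ)"
proof (rule order_cont_dualD[OF assms(1,2) order_convergesI[OF assms(2,3)]])
  show "\<exists>a0\<in>J. \<forall>a\<in>J. leJ a0 a \<longrightarrow> \<bar>y a - 0\<bar> \<le> y c" if "c \<in> J" for c
    using assms(3) that by (intro bexI[of _ c]) (auto simp: decreases_to_zero_def abs_of_nonneg)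
qed

text \<open>Each member of a dominating net bounds a tail of the given net, so small values of
  \<open>\<mu>\<close> on the dominating net make \<open>\<psi>\<close> small on tails. The case
  \<open>\<psi> = \<mu>\<close> gives a criterion for positive functionals, other
  \<open>\<psi>\<close> give the ideal property.\<close>

lemma order_cont_dualI:
  fixes \<mu> :: "'a::banach_lattice \<Rightarrow> real"
  assumes \<psi>: "linear \<psi>" "\<And>x. \<bar>\<psi> x\<bar> \<le> \<mu> \<bar>x\<bar>" and \<mu>: "positive_functional \<mu>"
    and inf: "\<And>(J::'a set) leJ y e. directed_set J leJ \<Longrightarrow> decreases_to_zero J leJ y \<Longrightarrow> 0 < e \<Longrightarrow>
      \<exists>c\<in>J. \<mu> (y c) < e"
  shows "\<psi> \<in> order_cont_dual"
  unfolding order_cont_dual_def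
proof (intro CollectI conjI allI impI \<psi>(1))
  fix I :: "('a \<times> 'a set) set" and le and x :: "'a \<times> 'a set \<Rightarrow> 'a"
  assume dir: "directed_set I le" and "order_converges I le x 0"
  then obtain J :: "'a set" and leJ y where J: "directed_set J leJ" "decreases_to_zero J leJ y"
    and dom: "\<forall>c\<in>J. \<exists>a0\<in>I. \<forall>a\<in>I. le a0 a \<longrightarrow> \<bar>x a\<bar> \<le> y c"
    unfolding order_converges_def diff_zero by blast
  show "((\<lambda>a. \<psi> (x a)) \<longlongrightarrow> 0) (net_filter I le)"
    unfolding tendsto_iff eventually_net_filter[OF dir]
  proof (intro allI impI)
    fix e :: real assume "0 < e"
    with inf[OF J] obtain c where c: "c \<in> J" "\<mu> (y c) < e" by blast
    have "dist (\<psi> v) 0 < e" if "\<bar>v\<bar> \<le> y c" for v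
      using \<psi>(2)[of v] positive_functional_mono[OF \<mu> that] c(2) by simp
    with dom c(1) show "\<exists>a0\<in>I. \<forall>a\<in>I. le a0 a \<longrightarrow> dist (\<psi> (x a)) 0 < e" by blast
  qed
qed

lemma order_cont_dual_dominated:
  fixes \<mu> :: "'a::banach_lattice \<Rightarrow> real"
  assumes \<psi>: "linear \<psi>" "\<And>x. \<bar>\<psi> x\<bar> \<le> \<mu> \<bar>x\<bar>" and \<mu>: "positive_functional \<mu>" "\<mu> \<in> order_cont_dual"
  shows "\<psi> \<in> order_cont_dual"
proof (rule order_cont_dualI[OF \<psi> \<mu>(1)])
  fix J :: "'a set" and leJ and y :: "'a \<Rightarrow> 'a" and e :: real
  assume J: "directed_set J leJ" "decreases_to_zero J leJ y" and "0 < e"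
  then have "eventually (\<lambda>a. \<mu> (y a) < e) (net_filter J leJ)"
    using order_tendstoD(2)[OF order_cont_dual_decreasing[OF \<mu>(2) J]] by blast
  then obtain a where a: "a \<in> J" "\<forall>b\<in>J. leJ a b \<longrightarrow> \<mu> (y b) < e"
    unfolding eventually_net_filter[OF J(1)] by blast
  moreover have "leJ a a" using J(1) a(1) by (simp add: directed_set_def)
  ultimately show "\<exists>c\<in>J. \<mu> (y c) < e" by blast
qed

lemma decreases_to_zero_inverse_Suc:
  fixes x :: "'a::banach_lattice"
  assumes "0 \<le> x"
  shows "decreases_to_zero UNIV (\<le>) (\<lambda>n::nat. inverse (real (Suc n)) *\<^sub>R x)"
  unfolding decreases_to_zero_def
proof (intro conjI ballI allI impI)
  show "inverse (real (Suc b)) *\<^sub>R x \<le> inverse (real (Suc a)) *\<^sub>R x" if "a \<le> b" for a b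
    using that assms by (intro scaleR_right_mono le_imp_inverse_le) auto
  show "0 \<le> inverse (real (Suc a)) *\<^sub>R x" for a using assms by (simp add: scaleR_nonneg_nonneg)
  fix z assume z: "\<forall>a\<in>UNIV. z \<le> inverse (real (Suc a)) *\<^sub>R x"
  have "real n *\<^sub>R z \<le> x" for n
  proof (cases n)
    case (Suc m)
    have "real n *\<^sub>R z \<le> real n *\<^sub>R inverse (real (Suc m)) *\<^sub>R x"
      using z by (intro scaleR_left_mono) auto
    then show ?thesis by (simp add: Suc del: of_nat_Suc)
  qed (simp add: assms)
  then show "z \<le> 0" by (rule banach_lattice_archimedean)
qed

text \<open>Otherwise some \<open>y n\<close> with \<open>\<bar>y n\<bar> \<le> x\<close> satisfy
  \<open>real (Suc n) < \<phi> (y n)\<close>. Divided by \<open>real (Suc n)\<close> they order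
  converge to \<open>0\<close>, because the space is Archimedean, while \<open>\<phi>\<close> stays
  at least \<open>1\<close> on them.\<close>

lemma order_cont_dual_order_bounded:
  assumes \<phi>: "\<phi> \<in> order_cont_dual" and x: "0 \<le> x"
  shows "bdd_above (\<phi> ` {y. \<bar>y\<bar> \<le> x})"
proof (rule ccontr)
  assume "\<not> ?thesis"
  then have "\<forall>K. \<exists>y. \<bar>y\<bar> \<le> x \<and> K < \<phi> y" by (simp add: bdd_above_def not_le)
  then have "\<forall>n. \<exists>y. \<bar>y\<bar> \<le> x \<and> real (Suc n) < \<phi> y" by blast
  then obtain y where y: "\<And>n. \<bar>y n\<bar> \<le> x" "\<And>n. real (Suc n) < \<phi> (y n)" by metis
  let ?z = "\<lambda>n. inverse (real (Suc n)) *\<^sub>R y n"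
  have z: "\<bar>?z n\<bar> \<le> inverse (real (Suc n)) *\<^sub>R x" for n
    using y(1)[of n] by (simp add: abs_scaleR_nonneg scaleR_left_mono del: of_nat_Suc)
  have "order_converges UNIV (\<le>) ?z 0"
  proof (rule order_convergesI[OF directed_set_nat decreases_to_zero_inverse_Suc[OF x]])
    show "\<exists>a0\<in>UNIV. \<forall>a\<in>UNIV. a0 \<le> a \<longrightarrow> \<bar>?z a - 0\<bar> \<le> inverse (real (Suc c)) *\<^sub>R x" for c
    proof (intro bexI[of _ c] ballI impI UNIV_I)
      fix a assume "c \<le> a"
      then have "inverse (real (Suc a)) *\<^sub>R x \<le> inverse (real (Suc c)) *\<^sub>R x"
        using x by (intro scaleR_right_mono le_imp_inverse_le) auto
      with z[of a] show "\<bar>?z a - 0\<bar> \<le> inverse (real (Suc c)) *\<^sub>R x"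
        by (simp del: of_nat_Suc)
    qed
  qed
  from order_cont_dualD[OF \<phi> directed_set_nat this]
  have "(\<lambda>n. \<phi> (?z n)) \<longlonglongrightarrow> 0" by (simp add: net_filter_nat)
  moreover have "1 \<le> \<phi> (?z n)" for n
    using y(2)[of n] by (simp add: linear_scale[OF order_cont_dual_linear[OF \<phi>]] field_simps)
  ultimately have "(1::real) \<le> 0" by (intro tendsto_lowerbound[where f = "\<lambda>n. \<phi> (?z n)"]) auto
  then show False by simp
qed

section \<open>The modulus of an order continuous functional\<close>

text \<open>On the cone \<open>\<mu>\<close> is the Riesz-Kantorovich supremum of
  \<open>\<phi> y\<close> over \<open>\<bar>y\<bar> \<le> x\<close>, as the last two clauses record.
  Adding vectors makes it superadditive, the Riesz decomposition makes it subadditive.\<close>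

lemma order_cont_dual_modulus_ex:
  fixes \<phi> :: "'a::banach_lattice \<Rightarrow> real"
  assumes \<phi>: "\<phi> \<in> order_cont_dual"
  shows "\<exists>\<mu>. positive_functional \<mu> \<and> \<mu> \<in> order_cont_dual \<and>
    (\<forall>x y. \<bar>y\<bar> \<le> x \<longrightarrow> \<phi> y \<le> \<mu> x) \<and> (\<forall>x\<ge>0. \<forall>e>0. \<exists>y. \<bar>y\<bar> \<le> x \<and> \<mu> x - e < \<phi> y)"
proof -
  note lin = order_cont_dual_linear[OF \<phi>]
  define p where "p x = (SUP y\<in>{y. \<bar>y\<bar> \<le> x}. \<phi> y)" for x :: 'a
  have upper: "\<phi> y \<le> p x" if "\<bar>y\<bar> \<le> x" for x y
  proof -
    have "0 \<le> x" using abs_ge_zero[of y] that by (rule order_trans)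
    then show ?thesis unfolding p_def
      using that by (intro cSUP_upper order_cont_dual_order_bounded[OF \<phi>]) auto
  qed
  have least: "p x \<le> K" if "0 \<le> x" "\<And>y. \<bar>y\<bar> \<le> x \<Longrightarrow> \<phi> y \<le> K" for x K
    unfolding p_def using that by (intro cSUP_least) (auto intro: exI[of _ 0])
  have approx: "\<exists>y. \<bar>y\<bar> \<le> x \<and> p x - e < \<phi> y" if "0 \<le> x" "0 < e" for x e
  proof (rule ccontr)
    assume "\<not> ?thesis"
    then have "p x \<le> p x - e" using that(1) by (intro least) (auto simp: not_less)
    with that(2) show False by simp
  qed
  have "p (x + y) = p x + p y" if x: "0 \<le> x" and y: "0 \<le> y" for x y
  proof (rule order_antisym)
    have "p x \<le> p (x + y) - p y" using x
    proof (rule least)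
      fix u assume u: "\<bar>u\<bar> \<le> x"
      have "p y \<le> p (x + y) - \<phi> u" using y
      proof (rule least)
        fix v assume "\<bar>v\<bar> \<le> y"
        then have "\<bar>u + v\<bar> \<le> x + y" using u by (intro order_trans[OF abs_triangle_ineq add_mono])
        from upper[OF this] show "\<phi> v \<le> p (x + y) - \<phi> u" by (simp add: linear_add[OF lin])
      qed
      then show "\<phi> u \<le> p (x + y) - p y" by simp
    qed
    then show "p x + p y \<le> p (x + y)" by simp
    show "p (x + y) \<le> p x + p y"
    proof (rule least)
      fix w assume w: "\<bar>w\<bar> \<le> x + y"
      let ?u = "sup (inf w x) (- x)"
      have "\<phi> w = \<phi> ?u + \<phi> (w - ?u)" by (simp only: linear_diff[OF lin] add_diff_cancel_left' add_diff_eq)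
      also have "\<dots> \<le> p x + p y"
        by (intro add_mono upper riesz_decomposition[OF x y w])
      finally show "\<phi> w \<le> p x + p y" .
    qed (use x y in auto)
  qed
  moreover have "c * p x \<le> p (c *\<^sub>R x)" if c: "0 < c" and x: "0 \<le> x" for c x
  proof -
    have "p x \<le> p (c *\<^sub>R x) / c" using x
    proof (rule least)
      fix y assume "\<bar>y\<bar> \<le> x"
      then have "\<bar>c *\<^sub>R y\<bar> \<le> c *\<^sub>R x" using c by (simp add: abs_scaleR_nonneg scaleR_left_mono)
      from upper[OF this] show "\<phi> y \<le> p (c *\<^sub>R x) / c"
        using c by (simp add: linear_scale[OF lin] field_simps)
    qed
    then show ?thesis using c by (simp add: field_simps)
  qed
  moreover have "0 \<le> p x" if "0 \<le> x" for x
    using upper[of 0 x] that by (simp add: linear_0[OF lin])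
  ultimately obtain \<mu> where pos: "positive_functional \<mu>" and eq: "\<And>x. 0 \<le> x \<Longrightarrow> \<mu> x = p x"
    using positive_functional_extension[of p] by blast
  have upper': "\<phi> y \<le> \<mu> x" if "\<bar>y\<bar> \<le> x" for x y
    using upper[OF that] eq[of x] that order_trans[OF abs_ge_zero that] by simp
  have approx': "\<exists>y. \<bar>y\<bar> \<le> x \<and> \<mu> x - e < \<phi> y" if "0 \<le> x" "0 < e" for x e
    using approx[OF that] eq[OF that(1)] by simp
  have "\<mu> \<in> order_cont_dual"
  proof (rule order_cont_dualI[OF positive_functional_linear[OF pos] abs_positive_functional_le[OF pos] pos])
    fix J :: "'a set" and leJ and x :: "'a \<Rightarrow> 'a" and e :: real
    assume J: "directed_set J leJ" and x: "decreases_to_zero J leJ x" and e: "0 < e"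
    from J obtain b where b: "b \<in> J" unfolding directed_set_def by blast
    have x_pos: "0 \<le> x a" if "a \<in> J" for a using x that by (simp add: decreases_to_zero_def)
    have x_mono: "x d \<le> x c" if "c \<in> J" "d \<in> J" "leJ c d" for c d
      using x that by (simp add: decreases_to_zero_def)
    \<comment> \<open>This \<open>y\<close> nearly attains the supremum at the fixed index
      \<open>b\<close>; the later members of the net only clip it.\<close>
    obtain y where y: "\<bar>y\<bar> \<le> x b" "\<mu> (x b) - e / 2 < \<phi> y"
      using approx'[OF x_pos[OF b], of "e / 2"] e by auto
    let ?y = "\<lambda>a. sup (inf y (x a)) (- x a)"
    have split: "\<bar>?y a\<bar> \<le> x a" "\<bar>y - ?y a\<bar> \<le> x b - x a" if "a \<in> J" "leJ b a" for a
      using riesz_decomposition[of "x a" "x b - x a" y] x_pos[OF that(1)] x_mono[OF b that] y(1) by auto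
    have ylim: "((\<lambda>a. \<phi> (?y a)) \<longlongrightarrow> 0) (net_filter J leJ)"
    proof (rule order_cont_dualD[OF \<phi> J order_convergesI[OF J x]])
      fix c assume c: "c \<in> J"
      then obtain d where d: "d \<in> J" "leJ b d" "leJ c d"
        using J b unfolding directed_set_def by meson
      have "\<bar>?y a\<bar> \<le> x c" if a: "a \<in> J" "leJ d a" for a
      proof -
        have "leJ b a" "leJ c a" using J a b c d unfolding directed_set_def by blast+
        then show ?thesis using split(1)[of a] x_mono[of c a] a(1) c by (blast intro: order_trans)
      qed
      then show "\<exists>d\<in>J. \<forall>a\<in>J. leJ d a \<longrightarrow> \<bar>?y a - 0\<bar> \<le> x c" using d(1) by auto
    qed
    have "eventually (\<lambda>a. \<phi> (?y a) < e / 2) (net_filter J leJ)"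
      using order_tendstoD(2)[OF ylim, of "e / 2"] e by simp
    then obtain c where c: "c \<in> J" "\<forall>a\<in>J. leJ c a \<longrightarrow> \<phi> (?y a) < e / 2"
      unfolding eventually_net_filter[OF J] by blast
    from J b c(1) obtain d where d: "d \<in> J" "leJ b d" "leJ c d"
      unfolding directed_set_def by meson
    \<comment> \<open>The part of \<open>y\<close> that is cut off contributes at most
      \<open>\<mu> (x b) - \<mu> (x d)\<close>. As \<open>\<phi> y\<close> is within
      \<open>e / 2\<close> of \<open>\<mu> (x b)\<close> and the clipped part contributes less than
      \<open>e / 2\<close>, this leaves \<open>\<mu> (x d) < e\<close>.\<close>
    have "\<phi> y - \<phi> (?y d) \<le> \<mu> (x b) - \<mu> (x d)"
      using upper'[OF split(2)[OF d(1,2)]]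
      by (simp only: linear_diff[OF lin] linear_diff[OF positive_functional_linear[OF pos]])
    moreover have "\<phi> (?y d) < e / 2" using c(2) d by blast
    ultimately have "\<mu> (x d) < e" using y(2) by linarith
    with d(1) show "\<exists>c\<in>J. \<mu> (x c) < e" by blast
  qed
  then show ?thesis using pos upper' approx' by blast
qed

text \<open>Identifies the modulus defined by a description with the one given by the supremum
  formula. For leastness, any \<open>\<theta>\<close> above \<open>\<phi>\<close> and its negative
  is positive and satisfies \<open>\<phi> y \<le> \<theta> \<bar>y\<bar> \<le> \<theta> x\<close>
  whenever \<open>\<bar>y\<bar> \<le> x\<close>.\<close>

lemma functional_abs_order_cont_dual:
  fixes \<phi> :: "'a::banach_lattice \<Rightarrow> real"
  assumes \<phi>: "\<phi> \<in> order_cont_dual"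
  defines "\<mu> \<equiv> functional_abs order_cont_dual \<phi>"
  shows functional_abs_positive: "positive_functional \<mu>"
    and functional_abs_in_order_cont_dual: "\<mu> \<in> order_cont_dual"
    and functional_abs_upper: "\<bar>y\<bar> \<le> x \<Longrightarrow> \<phi> y \<le> \<mu> x"
    and functional_abs_approx: "0 \<le> x \<Longrightarrow> 0 < e \<Longrightarrow> \<exists>y. \<bar>y\<bar> \<le> x \<and> \<mu> x - e < \<phi> y"
proof -
  note lin = order_cont_dual_linear[OF \<phi>]
  obtain \<nu> where pos: "positive_functional \<nu>" and oc: "\<nu> \<in> order_cont_dual"
    and upper: "\<forall>x y. \<bar>y\<bar> \<le> x \<longrightarrow> \<phi> y \<le> \<nu> x"
    and approx: "\<forall>x\<ge>0. \<forall>e>0. \<exists>y. \<bar>y\<bar> \<le> x \<and> \<nu> x - e < \<phi> y"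
    using order_cont_dual_modulus_ex[OF \<phi>] by blast
  have "is_functional_sup order_cont_dual {\<phi>, \<lambda>x. - \<phi> x} \<nu>"
    unfolding is_functional_sup_def
  proof (intro conjI ballI impI oc)
    show "functional_le \<psi> \<nu>" if "\<psi> \<in> {\<phi>, \<lambda>x. - \<phi> x}" for \<psi>
      unfolding functional_le_def
    proof (intro allI impI)
      fix x :: 'a assume "0 \<le> x"
      then show "\<psi> x \<le> \<nu> x"
        using that upper[rule_format, of x x] upper[rule_format, of "- x" x]
        by (auto simp: abs_of_nonneg linear_neg[OF lin])
    qed
    fix \<theta> assume \<theta>: "\<theta> \<in> order_cont_dual" "\<forall>\<psi>\<in>{\<phi>, \<lambda>x. - \<phi> x}. functional_le \<psi> \<theta>"
    have le: "\<phi> x \<le> \<theta> x" "- \<phi> x \<le> \<theta> x" if "0 \<le> x" for x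
      using \<theta>(2) that by (auto simp: functional_le_def)
    have \<theta>_pos: "positive_functional \<theta>"
      unfolding positive_functional_def
    proof (intro conjI allI impI order_cont_dual_linear[OF \<theta>(1)])
      show "0 \<le> \<theta> x" if "0 \<le> x" for x using le[OF that] by linarith
    qed
    show "functional_le \<nu> \<theta>"
      unfolding functional_le_def
    proof (intro allI impI)
      fix x :: 'a assume x: "0 \<le> x"
      show "\<nu> x \<le> \<theta> x"
      proof (rule field_le_epsilon)
        fix e :: real assume "0 < e"
        with approx x obtain y where y: "\<bar>y\<bar> \<le> x" "\<nu> x - e < \<phi> y" by blast
        have "\<phi> y = \<phi> (pprt y) - \<phi> (pprt (- y))"
          by (simp only: pprt_minus_pprt_uminus flip: linear_diff[OF lin])
        also have "\<dots> \<le> \<theta> (pprt y) + \<theta> (pprt (- y))"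
          using le(1)[of "pprt y"] le(2)[of "pprt (- y)"] by simp
        also have "\<dots> = \<theta> \<bar>y\<bar>"
          by (simp add: abs_eq_pprt_add_pprt linear_add[OF order_cont_dual_linear[OF \<theta>(1)]])
        also have "\<dots> \<le> \<theta> x" by (rule positive_functional_mono[OF \<theta>_pos y(1)])
        finally show "\<nu> x \<le> \<theta> x + e" using y(2) by simp
      qed
    qed
  qed
  then have "\<mu> = \<nu>"
    unfolding \<mu>_def by (intro functional_abs_eqI order_cont_dual_linear)
  then show "positive_functional \<mu>" "\<mu> \<in> order_cont_dual" "\<bar>y\<bar> \<le> x \<Longrightarrow> \<phi> y \<le> \<mu> x"
    "0 \<le> x \<Longrightarrow> 0 < e \<Longrightarrow> \<exists>y. \<bar>y\<bar> \<le> x \<and> \<mu> x - e < \<phi> y"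
    using pos oc upper approx by blast+
qed

lemma abs_le_functional_abs:
  assumes "\<phi> \<in> order_cont_dual"
  shows "\<bar>\<phi> y\<bar> \<le> functional_abs order_cont_dual \<phi> \<bar>y\<bar>"
  using functional_abs_upper[OF assms, of y "\<bar>y\<bar>"] functional_abs_upper[OF assms, of "- y" "\<bar>y\<bar>"]
  by (simp add: linear_neg[OF order_cont_dual_linear[OF assms]])

lemma functional_abs_of_positive:
  assumes "\<psi> \<in> order_cont_dual" "functional_le (\<lambda>_. 0) \<psi>"
  shows "functional_abs order_cont_dual \<psi> = \<psi>"
proof (rule functional_abs_eqI[OF order_cont_dual_linear])
  show "is_functional_sup order_cont_dual {\<psi>, \<lambda>x. - \<psi> x} \<psi>"
    unfolding is_functional_sup_def functional_le_def
  proof (intro conjI ballI impI assms(1) allI)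
    fix \<theta> x assume "\<theta> \<in> {\<psi>, \<lambda>x. - \<psi> x}" "(0::'a) \<le> x"
    then show "\<theta> x \<le> \<psi> x" using assms(2) by (force simp: functional_le_def)
  qed auto
qed

section \<open>Disjoint sequences\<close>

text \<open>For \<open>m < n\<close> the vectors \<open>u m\<close> and \<open>u n\<close> lie below
  the positive and the negative part of the same vector, \<open>4 ^ n *\<^sub>R x m - x n\<close>.
  The sum subtracted in \<open>u n\<close> contains \<open>x m\<close>, and the term
  \<open>(1/2) ^ m *\<^sub>R s\<close> subtracted in \<open>u m\<close> absorbs
  \<open>(1/4) ^ n *\<^sub>R x n\<close>.\<close>

lemma disjointification:
  fixes x :: "nat \<Rightarrow> 'a::banach_lattice"
  assumes pos: "\<And>n. 0 \<le> x n" and s: "0 \<le> s" "\<And>n. (1/2) ^ n *\<^sub>R x n \<le> s"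
  defines "u \<equiv> \<lambda>n. pprt (x n - 4 ^ n *\<^sub>R (\<Sum>i<n. x i) - (1/2) ^ n *\<^sub>R s)"
  assumes "m \<noteq> n"
  shows "inf (u m) (u n) = 0"
proof -
  have less: "inf (u m) (u n) = 0" if "m < n" for m n
  proof -
    let ?c = "(4::real) ^ n"
    let ?z = "?c *\<^sub>R x m - x n"
    \<comment> \<open>Of the two factors \<open>(1/2) ^ n\<close>, one turns \<open>x n\<close> into
      a vector below \<open>s\<close> and the other is compared with
      \<open>(1/2) ^ m\<close>.\<close>
    have "(1/4) ^ n *\<^sub>R x n \<le> (1/2) ^ m *\<^sub>R (1/2) ^ n *\<^sub>R x n"
    proof -
      have "(1/4::real) ^ n = (1/2) ^ n * (1/2) ^ n" by (simp flip: power_mult_distrib)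
      also have "\<dots> \<le> (1/2) ^ m * (1/2) ^ n"
        using that by (intro mult_right_mono power_decreasing) auto
      finally show ?thesis using pos[of n] by (simp add: scaleR_right_mono del: power_one_over)
    qed
    also have "\<dots> \<le> (1/2) ^ m *\<^sub>R s" using s(2) by (intro scaleR_left_mono) auto
    also have "\<dots> \<le> 4 ^ m *\<^sub>R (\<Sum>i<m. x i) + (1/2) ^ m *\<^sub>R s"
      using pos by (simp add: scaleR_nonneg_nonneg sum_nonneg)
    finally have "u m \<le> pprt (x m - (1/4) ^ n *\<^sub>R x n)"
      unfolding u_def by (intro pprt_mono) (simp only: diff_diff_add diff_left_mono)
    then have "?c *\<^sub>R u m \<le> ?c *\<^sub>R pprt (x m - (1/4) ^ n *\<^sub>R x n)" by (intro scaleR_left_mono) auto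
    also have "\<dots> = pprt ?z"
      by (simp add: scaleR_diff_right power_one_over flip: pprt_scaleR)
    finally have um: "?c *\<^sub>R u m \<le> pprt ?z" .
    have "x m \<le> (\<Sum>i<n. x i)" using that pos sum_mono2[of "{..<n}" "{m}" x] by simp
    then have "?c *\<^sub>R x m \<le> ?c *\<^sub>R (\<Sum>i<n. x i)" by (intro scaleR_left_mono) auto
    also have "\<dots> \<le> ?c *\<^sub>R (\<Sum>i<n. x i) + (1/2) ^ n *\<^sub>R s"
      using s(1) by (simp add: scaleR_nonneg_nonneg)
    finally have un: "u n \<le> pprt (- ?z)"
      unfolding u_def minus_diff_eq by (intro pprt_mono) (simp only: diff_diff_add diff_left_mono)
    have "u m \<le> ?c *\<^sub>R u m"
      using scaleR_right_mono[of 1 ?c "u m"] by (simp add: u_def)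
    with um have "u m \<le> pprt ?z" by (rule order_trans[rotated])
    then have "inf (u m) (u n) \<le> inf (pprt ?z) (pprt (- ?z))" using un by (rule inf_mono)
    then show ?thesis
      unfolding inf_pprt_pprt_uminus by (intro order_antisym) (auto simp: u_def)
  qed
  show ?thesis
    using less[of m n] less[of n m] assms(5) by (auto simp: inf_commute neq_iff)
qed

lemma positive_functional_tail_small:
  fixes \<mu> :: "'a::banach_lattice \<Rightarrow> real"
  assumes \<mu>: "positive_functional \<mu>" and "0 < e"
    and disj: "\<And>u. (\<And>n. 0 \<le> u n) \<Longrightarrow> norm_bounded_net UNIV u \<Longrightarrow> disjoint_sequence u \<Longrightarrow>
      (\<lambda>n. \<mu> (u n)) \<longlonglongrightarrow> 0"
  shows "\<exists>u\<ge>0. \<forall>x\<ge>0. norm x \<le> M \<longrightarrow> \<mu> (pprt (x - u)) < e"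
proof (rule ccontr)
  assume "\<not> ?thesis"
  \<comment> \<open>The choice function is to be total, so for \<open>u\<close> outside the cone the
    chosen vector only has to be positive and lie in the ball.\<close>
  then have "\<exists>x\<ge>0. norm x \<le> M \<and> (0 \<le> u \<longrightarrow> e \<le> \<mu> (pprt (x - u)))" for u
    by (cases "0 \<le> u") (meson not_le, metis norm_zero norm_ge_zero order_refl order_trans not_le)
  then have "\<exists>g. \<forall>u. 0 \<le> g u \<and> norm (g u) \<le> M \<and> (0 \<le> u \<longrightarrow> e \<le> \<mu> (pprt (g u - u)))"
    by (intro choice) blast
  then obtain g where g: "\<And>u. 0 \<le> g u" "\<And>u. norm (g u) \<le> M"
    "\<And>u. 0 \<le> u \<Longrightarrow> e \<le> \<mu> (pprt (g u - u))" by blast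
  \<comment> \<open>Each new vector depends on the earlier ones only through their sum, so primitive
    recursion on the partial sums is enough.\<close>
  define S where "S = rec_nat 0 (\<lambda>n a. a + g (4 ^ n *\<^sub>R a))"
  define x where "x n = g (4 ^ n *\<^sub>R S n)" for n
  have S: "S n = (\<Sum>i<n. x i)" for n by (induction n) (auto simp: S_def x_def)
  have x_eq: "x n = g (4 ^ n *\<^sub>R (\<Sum>i<n. x i))" for n by (rule x_def[unfolded S])
  have x_pos: "0 \<le> x n" and x_norm: "norm (x n) \<le> M" for n by (simp_all add: x_def g)
  obtain s where s: "0 \<le> s" "\<And>n. (1/2) ^ n *\<^sub>R x n \<le> s"
    using geometric_domination[of x M] x_pos x_norm by blast
  define u where "u n = pprt (x n - 4 ^ n *\<^sub>R (\<Sum>i<n. x i) - (1/2) ^ n *\<^sub>R s)" for n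
  have S_pos: "0 \<le> 4 ^ n *\<^sub>R (\<Sum>i<n. x i)" for n
    using x_pos by (simp add: scaleR_nonneg_nonneg sum_nonneg)
  have s_pos: "0 \<le> (1/2) ^ n *\<^sub>R s" for n using s(1) by (simp add: scaleR_nonneg_nonneg)
  have u_le: "u n \<le> x n" for n
  proof -
    have "x n - 4 ^ n *\<^sub>R (\<Sum>i<n. x i) - (1/2) ^ n *\<^sub>R s \<le> x n"
      using S_pos[of n] s_pos[of n] by (metis add_nonneg_nonneg diff_diff_add diff_le_eq le_add_same_cancel1)
    from pprt_mono[OF this] show ?thesis using x_pos[of n] by (simp add: u_def)
  qed
  have u_pos: "0 \<le> u n" for n by (simp add: u_def)
  have "norm (u n) \<le> M" for n using norm_mono_nonneg[OF u_pos u_le] x_norm order_trans by blast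
  then have "norm_bounded_net UNIV u" by (auto simp: norm_bounded_net_def bounded_iff)
  moreover have "disjoint_sequence u"
    using disjointification[OF x_pos s] by (simp add: disjoint_sequence_def u_pos abs_of_nonneg u_def)
  ultimately have "(\<lambda>n. \<mu> (u n)) \<longlonglongrightarrow> 0" using disj u_pos by blast
  \<comment> \<open>The vector subtracted to achieve disjointness costs at most
    \<open>(1/2) ^ n * \<mu> s\<close>. This vanishes in the limit, so the lower bound
    \<open>e\<close> survives and contradicts the convergence of \<open>\<mu> (u n)\<close>.\<close>
  then have "(\<lambda>n. \<mu> (u n) + (1/2) ^ n * \<mu> s) \<longlonglongrightarrow> 0 + 0 * \<mu> s"
    by (intro tendsto_intros LIMSEQ_power_zero) auto
  moreover have "e \<le> \<mu> (u n) + (1/2) ^ n * \<mu> s" for n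
  proof -
    have "e \<le> \<mu> (pprt (x n - 4 ^ n *\<^sub>R (\<Sum>i<n. x i)))"
      using g(3)[OF S_pos[of n]] unfolding x_eq[of n, symmetric] .
    also have "\<dots> \<le> \<mu> (u n + (1/2) ^ n *\<^sub>R s)"
      unfolding u_def by (intro positive_functional_mono[OF \<mu>] pprt_diff_ge s_pos)
    also have "\<dots> = \<mu> (u n) + (1/2) ^ n * \<mu> s"
      by (simp add: linear_add[OF positive_functional_linear[OF \<mu>]]
          linear_scale[OF positive_functional_linear[OF \<mu>]])
    finally show ?thesis .
  qed
  ultimately have "e \<le> 0 + 0 * \<mu> s" by (intro tendsto_lowerbound) auto
  with \<open>0 < e\<close> show False by simp
qed

text \<open>Vectors \<open>z n\<close> with \<open>\<bar>z n\<bar> \<le> u n\<close> that nearly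
  attain \<open>\<bar>\<phi>\<bar> (u n)\<close> inherit the norm bound and the disjointness of
  \<open>u\<close>, so the hypothesis on \<open>\<phi>\<close> applies to them.\<close>

lemma functional_abs_disjoint_null:
  fixes \<phi> :: "'a::banach_lattice \<Rightarrow> real"
  assumes \<phi>: "\<phi> \<in> order_cont_dual"
    and null: "\<And>x. norm_bounded_net UNIV x \<Longrightarrow> disjoint_sequence x \<Longrightarrow> (\<lambda>n. \<phi> (x n)) \<longlonglongrightarrow> 0"
    and u: "\<And>n. 0 \<le> u n" "norm_bounded_net UNIV u" "disjoint_sequence u"
  shows "(\<lambda>n. functional_abs order_cont_dual \<phi> (u n)) \<longlonglongrightarrow> 0"
proof -
  let ?\<mu> = "functional_abs order_cont_dual \<phi>"
  have "\<exists>z. \<bar>z\<bar> \<le> u n \<and> ?\<mu> (u n) - inverse (real (Suc n)) < \<phi> z" for n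
    using functional_abs_approx[OF \<phi> u(1)] by simp
  then have "\<exists>z. \<forall>n. \<bar>z n\<bar> \<le> u n \<and> ?\<mu> (u n) - inverse (real (Suc n)) < \<phi> (z n)"
    by (intro choice) blast
  then obtain z where z: "\<And>n. \<bar>z n\<bar> \<le> u n"
    "\<And>n. ?\<mu> (u n) - inverse (real (Suc n)) < \<phi> (z n)" by blast
  obtain M where M: "\<And>n. norm (u n) \<le> M" using u(2) by (auto simp: norm_bounded_net_def bounded_iff)
  have "norm (z n) \<le> M" for n
    using norm_mono_nonneg[OF abs_ge_zero z(1)[of n]] M[of n] by simp
  then have "norm_bounded_net UNIV z" by (auto simp: norm_bounded_net_def bounded_iff)
  moreover have "disjoint_sequence z"
    unfolding disjoint_sequence_def
  proof (intro allI impI order_antisym)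
    fix m n :: nat assume "m \<noteq> n"
    then have "inf (u m) (u n) = 0" using u(1,3) by (simp add: disjoint_sequence_def abs_of_nonneg)
    with inf_mono[OF z(1)[of m] z(1)[of n]] show "inf \<bar>z m\<bar> \<bar>z n\<bar> \<le> 0" by simp
  qed simp
  ultimately have "(\<lambda>n. \<phi> (z n) + inverse (real (Suc n))) \<longlonglongrightarrow> 0 + 0"
    by (intro tendsto_add null LIMSEQ_inverse_real_of_nat)
  then have lim: "(\<lambda>n. \<phi> (z n) + inverse (real (Suc n))) \<longlonglongrightarrow> 0" by simp
  have "0 \<le> ?\<mu> (u n)" for n
    by (rule positive_functional_nonneg[OF functional_abs_positive[OF \<phi>] u(1)])
  moreover have "?\<mu> (u n) \<le> \<phi> (z n) + inverse (real (Suc n))" for n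
    using z(2)[of n] by simp
  ultimately show ?thesis
    by (intro tendsto_sandwich[OF _ _ tendsto_const lim] always_eventually allI)
qed

section \<open>Consequences of uniformly small excess\<close>

text \<open>Cutting \<open>\<bar>x a\<bar>\<close> at \<open>u\<close> leaves truncations that are
  order null by uo-convergence, and excesses that are small uniformly in the index. The radius
  \<open>M\<close> is arbitrary because it is the norm bound of the given net.\<close>

lemma uo_dualI_tail_small:
  fixes \<phi> :: "'a::banach_lattice \<Rightarrow> real"
  assumes \<phi>: "\<phi> \<in> order_cont_dual"
    and small: "\<And>e M. 0 < e \<Longrightarrow>
      \<exists>u\<ge>0. \<forall>x\<ge>0. norm x \<le> M \<longrightarrow> functional_abs order_cont_dual \<phi> (pprt (x - u)) < e"
  shows "\<phi> \<in> uo_dual"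
  unfolding uo_dual_def
proof (intro CollectI conjI allI impI order_cont_dual_linear[OF \<phi>])
  let ?\<mu> = "functional_abs order_cont_dual \<phi>"
  note \<mu> = functional_abs_positive[OF \<phi>]
  fix I :: "('a \<times> 'a set) set" and le and x :: "'a \<times> 'a set \<Rightarrow> 'a"
  assume dir: "directed_set I le" and bdd: "norm_bounded_net I x" and uo: "uo_converges I le x 0"
  obtain M where M: "\<And>a. a \<in> I \<Longrightarrow> norm (x a) \<le> M" using bdd by (auto simp: norm_bounded_net_def bounded_iff)
  show "((\<lambda>a. \<phi> (x a)) \<longlongrightarrow> 0) (net_filter I le)"
    unfolding tendsto_iff eventually_net_filter[OF dir]
  proof (intro allI impI)
    fix e :: real assume "0 < e"
    then obtain u where u: "0 \<le> u" "\<And>x. 0 \<le> x \<Longrightarrow> norm x \<le> M \<Longrightarrow> ?\<mu> (pprt (x - u)) < e / 2"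
      using small[of "e / 2" M] by auto
    have "order_converges I le (\<lambda>a. inf \<bar>x a\<bar> u) 0"
      using uo u(1) by (simp add: uo_converges_def)
    from order_cont_dualD[OF functional_abs_in_order_cont_dual[OF \<phi>] dir this]
    have "eventually (\<lambda>a. ?\<mu> (inf \<bar>x a\<bar> u) < e / 2) (net_filter I le)"
      using \<open>0 < e\<close> by (intro order_tendstoD(2)[where y = 0]) auto
    then obtain b where b: "b \<in> I" "\<forall>a\<in>I. le b a \<longrightarrow> ?\<mu> (inf \<bar>x a\<bar> u) < e / 2"
      unfolding eventually_net_filter[OF dir] by blast
    have "dist (\<phi> (x a)) 0 < e" if "a \<in> I" "le b a" for a
    proof -
      have "\<bar>\<phi> (x a)\<bar> \<le> ?\<mu> \<bar>x a\<bar>" by (rule abs_le_functional_abs[OF \<phi>])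
      also have "\<dots> = ?\<mu> (inf \<bar>x a\<bar> u) + ?\<mu> (pprt (\<bar>x a\<bar> - u))"
        by (simp only: inf_add_pprt_diff flip: linear_add[OF positive_functional_linear[OF \<mu>]])
      also have "\<dots> < e / 2 + e / 2"
        using b(2) that M u(2)[of "\<bar>x a\<bar>"] by (intro add_strict_mono) auto
      finally show ?thesis by simp
    qed
    with b(1) show "\<exists>b\<in>I. \<forall>a\<in>I. le b a \<longrightarrow> dist (\<phi> (x a)) 0 < e" by blast
  qed
qed

text \<open>If \<open>\<psi>\<close> and \<open>\<theta>\<close> are disjoint and both below \<open>\<nu>\<close>, then \<open>\<psi> + \<theta> - \<nu>\<close> is below both of them, hence
  below \<open>0\<close>; this needs no lattice structure on the dual.\<close>

lemma sum_disjoint_functionals_le: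
  fixes \<psi> :: "nat \<Rightarrow> 'a::banach_lattice \<Rightarrow> real"
  assumes \<psi>: "\<And>n. \<psi> n \<in> order_cont_dual" "\<And>n. functional_le (\<lambda>_. 0) (\<psi> n)"
    and disj: "disjoint_functional_sequence order_cont_dual \<psi>"
    and \<nu>: "\<nu> \<in> order_cont_dual" "functional_le (\<lambda>_. 0) \<nu>" "\<And>i. i < n \<Longrightarrow> functional_le (\<psi> i) \<nu>"
    and x: "0 \<le> x"
  shows "(\<Sum>i<n. \<psi> i x) \<le> \<nu> x"
  using \<nu>
proof (induction n arbitrary: \<nu>)
  case 0
  then show ?case using x by (simp add: functional_le_def)
next
  case (Suc n)
  have le: "functional_le (\<psi> i) \<nu>" if "i < Suc n" for i using Suc.prems(3) that .
  \<comment> \<open>The last functional is removed from the bound, which is why the induction runs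
    over arbitrary \<open>\<nu>\<close>.\<close>
  have "(\<Sum>i<n. \<psi> i x) \<le> \<nu> x - \<psi> n x"
  proof (rule Suc.IH[OF order_cont_dual_diff[OF Suc.prems(1) \<psi>(1)]])
    show "functional_le (\<lambda>_. 0) (\<lambda>x. \<nu> x - \<psi> n x)" using le[of n] by (simp add: functional_le_def)
    fix i assume i: "i < n"
    have "is_functional_inf order_cont_dual {\<psi> i, \<psi> n} (\<lambda>_. 0)"
      using disj[unfolded disjoint_functional_sequence_def, rule_format, of i n] i
      by (simp add: functional_abs_of_positive \<psi>)
    moreover have "(\<lambda>x. \<psi> i x - (\<nu> x - \<psi> n x)) \<in> order_cont_dual"
      by (intro order_cont_dual_diff \<psi> Suc.prems(1))
    moreover have "\<forall>\<theta>\<in>{\<psi> i, \<psi> n}. functional_le (\<lambda>x. \<psi> i x - (\<nu> x - \<psi> n x)) \<theta>"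
      using le[of i] le[of n] i by (auto simp: functional_le_def algebra_simps)
    ultimately have "functional_le (\<lambda>x. \<psi> i x - (\<nu> x - \<psi> n x)) (\<lambda>_. 0)"
      unfolding is_functional_inf_def by blast
    then show "functional_le (\<psi> i) (\<lambda>x. \<nu> x - \<psi> n x)" by (simp add: functional_le_def)
  qed
  then show ?case by simp
qed

text \<open>One \<open>u\<close> serves all \<open>n\<close>: the excess over \<open>u\<close> is
  estimated by \<open>\<mu>\<close>, which dominates every \<open>\<psi> n\<close>, and the
  truncation contributes at most \<open>\<psi> n u\<close>, the term of a convergent series.\<close>

lemma onorm_null_if_tail_small:
  fixes \<mu> :: "'a::banach_lattice \<Rightarrow> real"
  assumes \<mu>: "\<mu> \<in> order_cont_dual" "functional_le (\<lambda>_. 0) \<mu>"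
    and small: "\<And>e. 0 < e \<Longrightarrow> \<exists>u\<ge>0. \<forall>x\<ge>0. norm x \<le> 1 \<longrightarrow> \<mu> (pprt (x - u)) < e"
    and \<psi>: "\<And>n. \<psi> n \<in> functional_interval order_cont_dual (\<lambda>_. 0) \<mu>"
    and disj: "disjoint_functional_sequence order_cont_dual \<psi>"
  shows "(\<lambda>n. onorm (\<psi> n)) \<longlonglongrightarrow> 0"
proof -
  have \<psi>_oc: "\<psi> n \<in> order_cont_dual" and \<psi>_ge: "functional_le (\<lambda>_. 0) (\<psi> n)"
    and \<psi>_le: "functional_le (\<psi> n) \<mu>" for n
    using \<psi>[of n] by (auto simp: functional_interval_def)
  have \<psi>_pos: "positive_functional (\<psi> n)" for n
    using \<psi>_ge order_cont_dual_linear[OF \<psi>_oc] by (simp add: positive_functional_def functional_le_def)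
  note lin = positive_functional_linear[OF \<psi>_pos]
  show ?thesis
    unfolding tendsto_iff
  proof (intro allI impI)
    fix e :: real assume e: "0 < e"
    then obtain u where u: "0 \<le> u" "\<And>x. 0 \<le> x \<Longrightarrow> norm x \<le> 1 \<Longrightarrow> \<mu> (pprt (x - u)) < e / 2"
      using small[of "e / 2"] by auto
    have bound: "onorm (\<psi> n) \<le> \<psi> n u + e / 2" for n
    proof (rule onorm_bound)
      show nonneg: "0 \<le> \<psi> n u + e / 2"
        using positive_functional_nonneg[OF \<psi>_pos u(1), of n] e by simp
      fix x :: 'a
      show "norm (\<psi> n x) \<le> (\<psi> n u + e / 2) * norm x"
      proof (cases "x = 0")
        case False
        let ?y = "inverse (norm x) *\<^sub>R \<bar>x\<bar>"
        have y: "0 \<le> ?y" "norm ?y \<le> 1" using False by (auto simp: scaleR_nonneg_nonneg)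
        have "\<psi> n ?y = \<psi> n (inf ?y u) + \<psi> n (pprt (?y - u))"
          by (simp only: inf_add_pprt_diff flip: linear_add[OF lin])
        also have "\<psi> n (inf ?y u) \<le> \<psi> n u" by (intro positive_functional_mono[OF \<psi>_pos]) simp
        also have "\<psi> n (pprt (?y - u)) \<le> \<mu> (pprt (?y - u))"
          using \<psi>_le[of n] by (simp add: functional_le_def)
        also have "\<dots> \<le> e / 2" using u(2)[OF y] by simp
        finally have "\<psi> n ?y \<le> \<psi> n u + e / 2" by simp
        then have "\<psi> n \<bar>x\<bar> \<le> (\<psi> n u + e / 2) * norm x"
          using False by (simp add: linear_scale[OF lin] field_simps)
        then show ?thesis using abs_positive_functional_le[OF \<psi>_pos, of n x] by simp
      qed (simp add: linear_0[OF lin])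
    qed
    have "summable (\<lambda>n. \<psi> n u)"
    proof (rule summableI_nonneg_bounded)
      show "0 \<le> \<psi> n u" for n by (rule positive_functional_nonneg[OF \<psi>_pos u(1)])
      show "(\<Sum>i<n. \<psi> i u) \<le> \<mu> u" for n
        by (rule sum_disjoint_functionals_le[OF \<psi>_oc \<psi>_ge disj \<mu> \<psi>_le u(1)])
    qed
    then have "eventually (\<lambda>n. \<psi> n u < e / 2) sequentially"
      using e by (intro order_tendstoD(2)[OF summable_LIMSEQ_zero]) auto
    then show "eventually (\<lambda>n. dist (onorm (\<psi> n)) 0 < e) sequentially"
    proof eventually_elim
      case (elim n)
      then show ?case
        using bound[of n] onorm_pos_le[OF positive_functional_bounded_linear[OF \<psi>_pos], of n] by simp
    qed
  qed
qed

section \<open>Components of a positive functional on disjoint bands\<close>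

lemma inf_add_eq_0:
  fixes a b c :: "'a::lattice_ab_group_add"
  assumes "0 \<le> a" "0 \<le> b" "0 \<le> c" "inf a c = 0" "inf b c = 0"
  shows "inf (a + b) c = 0"
proof (rule order_antisym)
  show "inf (a + b) c \<le> 0" using inf_add_le_inf_add_inf[OF assms(1-3)] assms(4,5) by simp
qed (simp add: assms(1-3))

lemma inf_scaleR_of_nat_eq_0:
  fixes v w :: "'a::banach_lattice"
  assumes "0 \<le> v" "0 \<le> w" "inf v w = 0"
  shows "inf (real k *\<^sub>R v) w = 0"
proof (induction k)
  case (Suc k)
  have "inf (v + real k *\<^sub>R v) w = 0"
    using assms Suc by (intro inf_add_eq_0) (auto simp: scaleR_nonneg_nonneg)
  then show ?case by (simp add: scaleR_left_distrib)
qed (use assms in \<open>simp add: inf_absorb1\<close>)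

text \<open>The component of \<open>\<mu>\<close> on the band generated by \<open>v\<close>, defined
  through truncations because that band need not be a projection band. The last two clauses say that
  \<open>\<psi> y\<close> is the supremum of \<open>\<mu> (inf y (real k *\<^sub>R v))\<close> over
  \<open>k\<close>.\<close>

lemma positive_functional_band_component:
  fixes \<mu> :: "'a::banach_lattice \<Rightarrow> real"
  assumes \<mu>: "positive_functional \<mu>" and v: "0 \<le> v"
  shows "\<exists>\<psi>. positive_functional \<psi> \<and> functional_le \<psi> \<mu> \<and>
    (\<forall>y\<ge>0. \<forall>k::nat. \<mu> (inf y (real k *\<^sub>R v)) \<le> \<psi> y) \<and>
    (\<forall>y\<ge>0. \<forall>e>0. \<exists>k::nat. \<psi> y - e < \<mu> (inf y (real k *\<^sub>R v)))"
proof -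
  note lin = positive_functional_linear[OF \<mu>] and mono = positive_functional_mono[OF \<mu>]
  define p where "p y = (SUP k::nat. \<mu> (inf y (real k *\<^sub>R v)))" for y
  have kv: "0 \<le> real k *\<^sub>R v" for k using v by (simp add: scaleR_nonneg_nonneg)
  have le_\<mu>: "\<mu> (inf y (real k *\<^sub>R v)) \<le> \<mu> y" for y k by (intro mono) simp
  have bdd: "bdd_above (range (\<lambda>k::nat. \<mu> (inf y (real k *\<^sub>R v))))" for y
    using le_\<mu>[of y] by (auto intro!: bdd_aboveI)
  have upper: "\<mu> (inf y (real k *\<^sub>R v)) \<le> p y" for y k
    unfolding p_def by (intro cSUP_upper bdd) simp
  have least: "p y \<le> K" if "\<And>k. \<mu> (inf y (real k *\<^sub>R v)) \<le> K" for y K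
    unfolding p_def using that by (intro cSUP_least) auto
  have approx: "\<exists>k. p y - e < \<mu> (inf y (real k *\<^sub>R v))" if "0 < e" for y e
  proof (rule ccontr)
    assume "\<not> ?thesis"
    then have "p y \<le> p y - e" by (intro least) (auto simp: not_less)
    with that show False by simp
  qed
  have "p (x + y) = p x + p y" if x: "0 \<le> x" and y: "0 \<le> y" for x y
  proof (rule order_antisym)
    show "p (x + y) \<le> p x + p y"
    proof (rule least)
      fix k
      have "\<mu> (inf (x + y) (real k *\<^sub>R v)) \<le> \<mu> (inf x (real k *\<^sub>R v) + inf y (real k *\<^sub>R v))"
        by (intro mono inf_add_le_inf_add_inf x y kv)
      also have "\<dots> \<le> p x + p y" unfolding linear_add[OF lin] by (intro add_mono upper)
      finally show "\<mu> (inf (x + y) (real k *\<^sub>R v)) \<le> p x + p y" .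
    qed
    have "p x \<le> p (x + y) - p y"
    proof (rule least)
      fix j
      have "p y \<le> p (x + y) - \<mu> (inf x (real j *\<^sub>R v))"
      proof (rule least)
        fix k
        \<comment> \<open>Superadditivity: the levels \<open>j\<close> and \<open>k\<close> chosen
          for the two summands merge into the level \<open>j + k\<close>.\<close>
        have "inf x (real j *\<^sub>R v) + inf y (real k *\<^sub>R v) \<le> inf (x + y) (real (j + k) *\<^sub>R v)"
          by (simp add: add_mono scaleR_left_distrib)
        from mono[OF this] upper[of "x + y" "j + k"]
        show "\<mu> (inf y (real k *\<^sub>R v)) \<le> p (x + y) - \<mu> (inf x (real j *\<^sub>R v))"
          by (simp add: linear_add[OF lin])
      qed
      then show "\<mu> (inf x (real j *\<^sub>R v)) \<le> p (x + y) - p y" by simp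
    qed
    then show "p x + p y \<le> p (x + y)" by simp
  qed
  moreover have "c * p x \<le> p (c *\<^sub>R x)" if c: "0 < c" and "0 \<le> x" for c x
  proof -
    have "p x \<le> p (c *\<^sub>R x) / c"
    proof (rule least)
      fix k :: nat
      \<comment> \<open>The scaled level \<open>c * real k\<close> need not be a natural number;
        rounding it up only enlarges the truncation.\<close>
      obtain j :: nat where j: "c * real k \<le> real j" using real_arch_simple by blast
      have "c * \<mu> (inf x (real k *\<^sub>R v)) = \<mu> (inf (c *\<^sub>R x) ((c * real k) *\<^sub>R v))"
        using c by (simp add: inf_scaleR_distrib flip: linear_scale[OF lin, unfolded real_scaleR_def])
      also have "\<dots> \<le> \<mu> (inf (c *\<^sub>R x) (real j *\<^sub>R v))"
        using j v by (intro mono inf_mono order_refl scaleR_right_mono)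
      also have "\<dots> \<le> p (c *\<^sub>R x)" by (rule upper)
      finally show "\<mu> (inf x (real k *\<^sub>R v)) \<le> p (c *\<^sub>R x) / c" using c by (simp add: field_simps)
    qed
    then show ?thesis using c by (simp add: field_simps)
  qed
  moreover have "0 \<le> p x" if "0 \<le> x" for x
    using upper[of x 0] that by (simp add: inf_absorb2 linear_0[OF lin])
  ultimately obtain \<psi> where \<psi>: "positive_functional \<psi>" "\<forall>y\<ge>0. \<psi> y = p y"
    using positive_functional_extension[of p] by blast
  moreover have "functional_le \<psi> \<mu>"
    using \<psi>(2) least[OF le_\<mu>] by (simp add: functional_le_def)
  ultimately show ?thesis using upper approx by (intro exI[of _ \<psi>]) auto
qed

lemma functional_le_imp_order_cont_dual:
  fixes \<mu> :: "'a::banach_lattice \<Rightarrow> real"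
  assumes "positive_functional \<psi>" "functional_le \<psi> \<mu>" "positive_functional \<mu>" "\<mu> \<in> order_cont_dual"
  shows "\<psi> \<in> order_cont_dual"
proof (rule order_cont_dual_dominated[OF positive_functional_linear[OF assms(1)] _ assms(3,4)])
  show "\<bar>\<psi> x\<bar> \<le> \<mu> \<bar>x\<bar>" for x
    using abs_positive_functional_le[OF assms(1), of x] assms(2)[unfolded functional_le_def, rule_format, of "\<bar>x\<bar>"]
    by simp
qed

lemma zero_in_order_cont_dual: "(\<lambda>_. 0) \<in> order_cont_dual"
  using linear_zero by (simp add: order_cont_dual_def)

text \<open>Here \<open>\<psi> n\<close> is the component of \<open>\<mu>\<close> on the band
  generated by \<open>\<bar>x n\<bar>\<close>. Below multiples of \<open>\<bar>x n\<bar>\<close> it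
  keeps the full value of \<open>\<mu>\<close> (\<open>on_band\<close>), below multiples of the
  other \<open>\<bar>x m\<bar>\<close> it vanishes (\<open>off_band\<close>); the two facts together
  give disjointness.\<close>

lemma disjoint_carriers:
  fixes x :: "nat \<Rightarrow> 'a::banach_lattice"
  assumes \<mu>: "positive_functional \<mu>" "\<mu> \<in> order_cont_dual" and x: "disjoint_sequence x"
  shows "\<exists>\<psi>. (\<forall>n. \<psi> n \<in> functional_interval order_cont_dual (\<lambda>_. 0) \<mu> \<and> \<mu> \<bar>x n\<bar> \<le> \<psi> n \<bar>x n\<bar>) \<and>
    disjoint_functional_sequence order_cont_dual \<psi>"
proof -
  have "\<exists>\<psi>. \<forall>n. positive_functional (\<psi> n) \<and> functional_le (\<psi> n) \<mu> \<and>
    (\<forall>y\<ge>0. \<forall>k::nat. \<mu> (inf y (real k *\<^sub>R \<bar>x n\<bar>)) \<le> \<psi> n y) \<and>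
    (\<forall>y\<ge>0. \<forall>e>0. \<exists>k::nat. \<psi> n y - e < \<mu> (inf y (real k *\<^sub>R \<bar>x n\<bar>)))"
    by (intro choice allI positive_functional_band_component \<mu>) simp
  then obtain \<psi> where pos: "\<And>n. positive_functional (\<psi> n)" and le: "\<And>n. functional_le (\<psi> n) \<mu>"
    and upper: "\<And>n y k. 0 \<le> y \<Longrightarrow> \<mu> (inf y (real k *\<^sub>R \<bar>x n\<bar>)) \<le> \<psi> n y"
    and approx: "\<And>n y e. 0 \<le> y \<Longrightarrow> 0 < e \<Longrightarrow> \<exists>k::nat. \<psi> n y - e < \<mu> (inf y (real k *\<^sub>R \<bar>x n\<bar>))"
    by blast
  have oc: "\<psi> n \<in> order_cont_dual" for n
    by (rule functional_le_imp_order_cont_dual[OF pos le \<mu>])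
  have nonneg: "functional_le (\<lambda>_. 0) (\<psi> n)" for n
    using positive_functional_nonneg[OF pos] by (simp add: functional_le_def)
  have kx: "0 \<le> real k *\<^sub>R \<bar>x n\<bar>" for k n by (simp add: scaleR_nonneg_nonneg)
  have on_band: "\<mu> w \<le> \<psi> n w" if "0 \<le> w" "w \<le> real k *\<^sub>R \<bar>x n\<bar>" for w n k
    using upper[OF that(1), of k n] that(2) by (simp add: inf_absorb1)
  have off_band: "\<psi> n w \<le> 0" if w: "0 \<le> w" "w \<le> real k *\<^sub>R \<bar>x m\<bar>" and mn: "m \<noteq> n" for w m n k
  proof (rule field_le_epsilon)
    have "inf w (real j *\<^sub>R \<bar>x n\<bar>) = 0" for j
    proof (rule order_antisym)
      have "inf \<bar>x m\<bar> \<bar>x n\<bar> = 0" using x mn by (simp add: disjoint_sequence_def)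
      then have "inf (real j *\<^sub>R \<bar>x n\<bar>) (real k *\<^sub>R \<bar>x m\<bar>) = 0"
        by (intro inf_scaleR_of_nat_eq_0 kx) (auto simp: inf_commute[of "\<bar>x n\<bar>"] inf_scaleR_of_nat_eq_0)
      then show "inf w (real j *\<^sub>R \<bar>x n\<bar>) \<le> 0"
        using inf_mono[OF w(2) order_refl, of "real j *\<^sub>R \<bar>x n\<bar>"] by (simp add: inf_commute)
    qed (simp add: w kx)
    then show "\<psi> n w \<le> 0 + e" if "0 < e" for e
      using approx[OF w(1) that, of n] by (simp add: linear_0[OF positive_functional_linear[OF \<mu>(1)]])
  qed
  have "disjoint_functional_sequence order_cont_dual \<psi>"
    unfolding disjoint_functional_sequence_def functional_abs_of_positive[OF oc nonneg]
      is_functional_inf_def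
  proof (intro allI impI conjI zero_in_order_cont_dual ballI)
    fix m n :: nat assume mn: "m \<noteq> n"
    show "functional_le (\<lambda>_. 0) \<theta>" if "\<theta> \<in> {\<psi> m, \<psi> n}" for \<theta> using that nonneg by blast
    fix \<theta> assume \<theta>: "\<theta> \<in> order_cont_dual" "\<forall>\<psi>\<in>{\<psi> m, \<psi> n}. functional_le \<theta> \<psi>"
    have le: "\<theta> v \<le> \<psi> m v" "\<theta> v \<le> \<psi> n v" if "0 \<le> v" for v
      using \<theta>(2) that by (simp_all add: functional_le_def)
    show "functional_le \<theta> (\<lambda>_. 0)"
      unfolding functional_le_def
    proof (intro allI impI, rule field_le_epsilon)
      fix y :: 'a and e :: real assume y: "0 \<le> y" and "0 < e"
      obtain k :: nat where k: "\<psi> m y - e < \<mu> (inf y (real k *\<^sub>R \<bar>x m\<bar>))"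
        using approx[OF y \<open>0 < e\<close>, of m] by (elim exE)
      \<comment> \<open>A common lower bound \<open>\<theta>\<close> is compared with
        \<open>\<psi> m\<close> on \<open>y - ?w\<close>, where \<open>\<psi> m\<close> is below
        \<open>e\<close> by the choice of \<open>k\<close>, and with \<open>\<psi> n\<close> on
        \<open>?w\<close>, where \<open>\<psi> n\<close> vanishes.\<close>
      let ?w = "inf y (real k *\<^sub>R \<bar>x m\<bar>)"
      have w: "0 \<le> ?w" "?w \<le> real k *\<^sub>R \<bar>x m\<bar>" using y kx by auto
      have "\<theta> y = \<theta> (y - ?w) + \<theta> ?w"
        by (simp only: linear_diff[OF order_cont_dual_linear[OF \<theta>(1)]] diff_add_cancel)
      also have "\<dots> \<le> \<psi> m (y - ?w) + \<psi> n ?w"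
        by (intro add_mono le w(1)) (simp only: diff_ge_0_iff_ge inf_le1)
      also have "\<dots> \<le> (\<psi> m y - \<psi> m ?w) + 0"
        unfolding linear_diff[OF positive_functional_linear[OF pos]]
        by (intro add_mono off_band[OF w mn]) simp
      also have "\<dots> \<le> 0 + e" using on_band[OF w] k by simp
      finally show "\<theta> y \<le> 0 + e" .
    qed
  qed
  moreover have "\<mu> \<bar>x n\<bar> \<le> \<psi> n \<bar>x n\<bar>" for n using on_band[of "\<bar>x n\<bar>" 1 n] by simp
  ultimately show ?thesis
    using oc nonneg le by (intro exI[of _ \<psi>]) (simp add: functional_interval_def)
qed

lemma disjoint_null_if_functionals_null:
  fixes \<phi> :: "'a::banach_lattice \<Rightarrow> real"
  assumes \<phi>: "\<phi> \<in> order_cont_dual"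
    and null: "\<And>\<psi>. \<forall>n. \<psi> n \<in> functional_interval order_cont_dual (\<lambda>_. 0) (functional_abs order_cont_dual \<phi>) \<Longrightarrow>
      disjoint_functional_sequence order_cont_dual \<psi> \<Longrightarrow> (\<lambda>n. onorm (\<psi> n)) \<longlonglongrightarrow> 0"
    and x: "norm_bounded_net UNIV x" "disjoint_sequence x"
  shows "(\<lambda>n. \<phi> (x n)) \<longlonglongrightarrow> 0"
proof -
  let ?\<mu> = "functional_abs order_cont_dual \<phi>"
  obtain \<psi> where \<psi>: "\<And>n. \<psi> n \<in> functional_interval order_cont_dual (\<lambda>_. 0) ?\<mu>"
    "\<And>n. ?\<mu> \<bar>x n\<bar> \<le> \<psi> n \<bar>x n\<bar>" "disjoint_functional_sequence order_cont_dual \<psi>"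
    using disjoint_carriers[OF functional_abs_positive[OF \<phi>] functional_abs_in_order_cont_dual[OF \<phi>] x(2)]
    by blast
  \<comment> \<open>\<open>onorm\<close> controls the values of a functional only if the functional
    is bounded; positivity ensures this.\<close>
  have bl: "bounded_linear (\<psi> n)" for n
    using \<psi>(1)[of n] order_cont_dual_linear[of "\<psi> n"]
    by (intro positive_functional_bounded_linear)
      (auto simp: functional_interval_def positive_functional_def functional_le_def)
  obtain M where M: "\<And>n. norm (x n) \<le> M" using x(1) by (auto simp: norm_bounded_net_def bounded_iff)
  have "\<bar>\<phi> (x n)\<bar> \<le> onorm (\<psi> n) * M" for n
  proof -
    have "\<bar>\<phi> (x n)\<bar> \<le> \<psi> n \<bar>x n\<bar>" using abs_le_functional_abs[OF \<phi>] \<psi>(2) by (rule order_trans)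
    also have "\<dots> \<le> onorm (\<psi> n) * norm (x n)" using onorm[OF bl, of n "\<bar>x n\<bar>"] by simp
    also have "\<dots> \<le> onorm (\<psi> n) * M" by (intro mult_left_mono M onorm_pos_le bl)
    finally show ?thesis .
  qed
  moreover have "(\<lambda>n. onorm (\<psi> n) * M) \<longlonglongrightarrow> 0"
    using tendsto_mult_right[OF null[OF _ \<psi>(3)], of M] \<psi>(1) by simp
  ultimately show ?thesis
    by (intro Lim_null_comparison[of "\<lambda>n. \<phi> (x n)" "\<lambda>n. onorm (\<psi> n) * M"]) simp_all
qed

section \<open>Order continuity of boundedly uo-continuous functionals\<close>

text \<open>An order null net need not be norm bounded, but its tail beyond \<open>b\<close> lies
  below a single \<open>y c\<close>. That tail is norm bounded and uo-null, and convergence along a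
  tail is convergence along the net.\<close>

lemma uo_dual_subset_order_cont_dual:
  "(uo_dual :: ('a::banach_lattice \<Rightarrow> real) set) \<subseteq> order_cont_dual"
proof
  fix \<phi> :: "'a \<Rightarrow> real" assume \<phi>: "\<phi> \<in> uo_dual"
  show "\<phi> \<in> order_cont_dual"
    unfolding order_cont_dual_def
  proof (intro CollectI conjI allI impI)
    show "linear \<phi>" using \<phi> by (simp add: uo_dual_def)
    fix I :: "('a \<times> 'a set) set" and le and x :: "'a \<times> 'a set \<Rightarrow> 'a"
    assume dir: "directed_set I le" and "order_converges I le x 0"
    then obtain J :: "'a set" and leJ y where J: "directed_set J leJ" "decreases_to_zero J leJ y"
      and dom: "\<forall>c\<in>J. \<exists>a0\<in>I. \<forall>a\<in>I. le a0 a \<longrightarrow> \<bar>x a\<bar> \<le> y c"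
      unfolding order_converges_def diff_zero by blast
    from J(1) obtain c where "c \<in> J" unfolding directed_set_def by blast
    with dom obtain b where b: "b \<in> I" "\<forall>a\<in>I. le b a \<longrightarrow> \<bar>x a\<bar> \<le> y c" by blast
    define I' where "I' = {a \<in> I. le b a}"
    have dir': "directed_set I' le"
      unfolding directed_set_def
    proof (intro conjI ballI impI)
      show "I' \<noteq> {}" using dir b(1) unfolding directed_set_def I'_def by blast
      show "le a a" if "a \<in> I'" for a using dir that unfolding directed_set_def I'_def by blast
      show "le a d" if "a \<in> I'" "c \<in> I'" "d \<in> I'" "le a c" "le c d" for a c d
        using dir that unfolding directed_set_def I'_def by blast
      fix a d assume a: "a \<in> I'" and d: "d \<in> I'"
      then obtain e where e: "e \<in> I" "le a e" "le d e"
        using dir unfolding directed_set_def I'_def by blast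
      moreover have "le b e" using dir a e b(1) unfolding directed_set_def I'_def by blast
      ultimately show "\<exists>e\<in>I'. le a e \<and> le d e" unfolding I'_def by blast
    qed
    have dom': "\<exists>a0\<in>I'. \<forall>a\<in>I'. le a0 a \<longrightarrow> \<bar>x a\<bar> \<le> y c" if "c \<in> J" for c
    proof -
      from dom that obtain a0 where a0: "a0 \<in> I" "\<forall>a\<in>I. le a0 a \<longrightarrow> \<bar>x a\<bar> \<le> y c" by blast
      then obtain d where d: "d \<in> I" "le b d" "le a0 d"
        using dir b(1) unfolding directed_set_def by meson
      have "\<forall>a\<in>I'. le d a \<longrightarrow> \<bar>x a\<bar> \<le> y c"
        using dir a0 d unfolding directed_set_def I'_def by blast
      then show ?thesis using d unfolding I'_def by blast
    qed
    have "norm (x a) \<le> norm (y c)" if "a \<in> I'" for a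
      using norm_mono_nonneg[of "\<bar>x a\<bar>" "y c"] b(2) that by (simp add: I'_def)
    then have "norm_bounded_net I' x" unfolding norm_bounded_net_def bounded_iff by blast
    moreover have "uo_converges I' le x 0"
      unfolding uo_converges_def
    proof (intro allI impI order_convergesI[OF J])
      fix z :: 'a and c assume "0 \<le> z" "c \<in> J"
      moreover have "\<bar>inf \<bar>x a\<bar> z\<bar> \<le> y c" if "\<bar>x a\<bar> \<le> y c" for a
        using that \<open>0 \<le> z\<close> by (simp add: abs_of_nonneg le_infI1)
      ultimately show "\<exists>a0\<in>I'. \<forall>a\<in>I'. le a0 a \<longrightarrow> \<bar>inf \<bar>x a - 0\<bar> z - 0\<bar> \<le> y c"
        using dom'[of c] unfolding diff_zero by blast
    qed
    ultimately have "((\<lambda>a. \<phi> (x a)) \<longlongrightarrow> 0) (net_filter I' le)" by (rule uo_dualD[OF \<phi> dir'])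
    moreover have "net_filter I le \<le> net_filter I' le"
      unfolding le_filter_def eventually_net_filter[OF dir] eventually_net_filter[OF dir']
    proof (intro allI impI)
      fix P assume "\<exists>a\<in>I'. \<forall>d\<in>I'. le a d \<longrightarrow> P d"
      then obtain a where a: "a \<in> I'" "\<forall>d\<in>I'. le a d \<longrightarrow> P d" by blast
      have "\<forall>d\<in>I. le a d \<longrightarrow> d \<in> I'"
        using dir a(1) b(1) unfolding directed_set_def I'_def by blast
      then show "\<exists>a\<in>I. \<forall>d\<in>I. le a d \<longrightarrow> P d" using a unfolding I'_def by blast
    qed
    ultimately show "((\<lambda>a. \<phi> (x a)) \<longlongrightarrow> 0) (net_filter I le)" by (rule filterlim_mono[OF _ order_refl])
  qed
qed

section \<open>Disjoint sequences are uo-null\<close>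

lemma disjoint_sequence_order_null:
  fixes z :: "nat \<Rightarrow> 'a::banach_lattice"
  assumes disj: "\<And>m n. m \<noteq> n \<Longrightarrow> inf (z m) (z n) = 0" and z: "\<And>n. 0 \<le> z n" "\<And>n. z n \<le> y"
  shows "order_converges UNIV (\<le>) z 0"
proof -
  \<comment> \<open>The dominating net consists of all eventual upper bounds of \<open>z\<close>. A lower bound \<open>w\<close> of this set must
    be disjoint from every \<open>z m\<close>, since adding \<open>inf (z m) w\<close> to a lower bound yields a lower bound;
    but then adding \<open>w\<close> itself also yields a lower bound.\<close>
  define D where "D = {u. \<exists>n. \<forall>k\<ge>n. z k \<le> u}"
  have DI: "u \<in> D" if "\<And>k. k \<ge> n \<Longrightarrow> z k \<le> u" for u n using that by (auto simp: D_def)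
  have yD: "y \<in> D" using z(2) by (intro DI[of 0]) auto
  have D_pos: "0 \<le> u" if "u \<in> D" for u using that z(1) by (auto simp: D_def intro: order_trans)
  have dir: "directed_set D (\<lambda>u v. v \<le> u)"
    unfolding directed_set_def
  proof (intro conjI ballI impI)
    show "D \<noteq> {}" using yD by blast
    fix u v assume "u \<in> D" "v \<in> D"
    then obtain m n where "\<And>k. k \<ge> m \<Longrightarrow> z k \<le> u" "\<And>k. k \<ge> n \<Longrightarrow> z k \<le> v" by (auto simp: D_def)
    then have "inf u v \<in> D" by (intro DI[of "max m n"]) auto
    then show "\<exists>c\<in>D. c \<le> u \<and> c \<le> v" by (intro bexI[of _ "inf u v"]) auto
  qed auto
  have "w' \<le> 0" if w': "\<And>u. u \<in> D \<Longrightarrow> w' \<le> u" for w'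
  proof -
    define w where "w = pprt w'"
    have w_pos: "0 \<le> w" by (simp add: w_def)
    have w: "w \<le> u" if "u \<in> D" for u
      using w'[OF that] D_pos[OF that] by (simp add: w_def pprt_def)
    \<comment> \<open>If adding \<open>g\<close> turns lower bounds of \<open>D\<close> above
      \<open>w\<close> into lower bounds, then so does adding any multiple of \<open>g\<close> to
      \<open>w\<close>. Hence \<open>real n *\<^sub>R g \<le> y\<close> for all \<open>n\<close>,
      and the Archimedean property applies.\<close>
    have iterate: "g \<le> 0"
      if step: "\<And>v. w \<le> v \<Longrightarrow> (\<And>u. u \<in> D \<Longrightarrow> v \<le> u) \<Longrightarrow> (\<And>u. u \<in> D \<Longrightarrow> v + g \<le> u)"
        and "0 \<le> g" for g
    proof -
      have "\<forall>u\<in>D. w + real n *\<^sub>R g \<le> u" for n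
      proof (induction n)
        case (Suc n)
        have "w \<le> w + real n *\<^sub>R g" using \<open>0 \<le> g\<close> by (simp add: scaleR_nonneg_nonneg)
        from step[OF this] Suc show ?case by (simp add: scaleR_left_distrib ac_simps)
      qed (simp add: w)
      then have "real n *\<^sub>R g \<le> y" for n
        using yD w_pos order_trans[of "real n *\<^sub>R g" "w + real n *\<^sub>R g" y] by simp
      then show ?thesis by (rule banach_lattice_archimedean)
    qed
    have disj_w: "inf (z m) w = 0" for m
    proof (rule order_antisym)
      show "inf (z m) w \<le> 0"
      proof (rule iterate)
        fix v u assume v: "w \<le> v" "\<And>u. u \<in> D \<Longrightarrow> v \<le> u" and u: "u \<in> D"
        from u obtain n where n: "\<And>k. k \<ge> n \<Longrightarrow> z k \<le> u" by (auto simp: D_def)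
        have "pprt (u - z m) \<in> D"
        proof (rule DI)
          \<comment> \<open>Starting beyond \<open>m\<close> guarantees \<open>k \<noteq> m\<close>,
            so \<open>z k\<close> and \<open>z m\<close> are disjoint and their sum stays below
            every common upper bound.\<close>
          fix k assume k: "max n (Suc m) \<le> k"
          then have "z k + z m \<le> sup u (z m)"
            using n[of k] by (intro add_le_if_disjoint disj) (auto intro: le_supI1)
          also have "\<dots> = pprt (u - z m) + z m" by (simp add: pprt_def add_sup_distrib_right)
          finally show "z k \<le> pprt (u - z m)" by simp
        qed
        then have "v \<le> pprt (u - z m)" by (rule v(2))
        also have "\<dots> \<le> pprt (u - inf (z m) w)" by (intro pprt_mono diff_left_mono) simp
        also have "\<dots> = u - inf (z m) w"
          using w[OF u] by (intro pprt_eq_id) (simp only: diff_ge_0_iff_ge le_infI2)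
        finally show "v + inf (z m) w \<le> u" unfolding le_diff_eq .
      qed (simp add: z(1) w_pos)
    qed (simp add: z(1) w_pos)
    have "w \<le> 0"
    proof (rule iterate[OF _ w_pos])
      fix v u assume v: "w \<le> v" "\<And>u. u \<in> D \<Longrightarrow> v \<le> u" and u: "u \<in> D"
      from u obtain n where n: "\<And>k. k \<ge> n \<Longrightarrow> z k \<le> u" by (auto simp: D_def)
      have "u - w \<in> D"
        using add_le_if_disjoint[OF disj_w n w[OF u]] by (intro DI) (simp add: le_diff_eq)
      then have "v \<le> u - w" by (rule v(2))
      then show "v + w \<le> u" by (simp add: le_diff_eq)
    qed
    with w_pos have "pprt w' = 0" unfolding w_def by (rule order_antisym[rotated])
    then show "w' \<le> 0" by (simp add: le_zero_iff_zero_pprt)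
  qed
  then have dec: "decreases_to_zero D (\<lambda>u v. v \<le> u) id"
    unfolding decreases_to_zero_def using D_pos by auto
  show ?thesis
  proof (rule order_convergesI[OF dir dec])
    fix u assume "u \<in> D"
    then show "\<exists>a0\<in>UNIV. \<forall>a\<in>UNIV. a0 \<le> a \<longrightarrow> \<bar>z a - 0\<bar> \<le> id u"
      using z(1) by (auto simp: D_def abs_of_nonneg)
  qed
qed

text \<open>Truncation at \<open>y\<close> preserves disjointness and supplies the order bound under
  which disjoint sequences are order null.\<close>

lemma disjoint_sequence_uo_null:
  assumes "disjoint_sequence x"
  shows "uo_converges UNIV (\<le>) x 0"
  unfolding uo_converges_def diff_zero
proof (intro allI impI)
  fix y :: 'a assume y: "0 \<le> y"
  show "order_converges UNIV (\<le>) (\<lambda>n. inf \<bar>x n\<bar> y) 0"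
  proof (rule disjoint_sequence_order_null[where y = y])
  show "inf (inf \<bar>x m\<bar> y) (inf \<bar>x n\<bar> y) = 0" if "m \<noteq> n" for m n
  proof (rule order_antisym)
    have "inf (inf \<bar>x m\<bar> y) (inf \<bar>x n\<bar> y) \<le> inf \<bar>x m\<bar> \<bar>x n\<bar>" by (intro inf_mono) auto
    also have "\<dots> = 0" using assms that by (simp add: disjoint_sequence_def)
    finally show "inf (inf \<bar>x m\<bar> y) (inf \<bar>x n\<bar> y) \<le> 0" .
  qed (simp add: y)
qed (auto simp: y)
qed

section \<open>The equivalences and the description of the uo-dual\<close>

theorem theorem2p3:
  shows "(uo_dual :: ('a::banach_lattice \<Rightarrow> real) set) = order_cont_part order_cont_dual \<and>
    (\<forall>\<phi> \<in> (order_cont_dual :: ('a \<Rightarrow> real) set).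
      (\<phi> \<in> uo_dual \<longleftrightarrow>
        (\<forall>x :: nat \<Rightarrow> 'a. norm_bounded_net UNIV x \<longrightarrow> uo_converges UNIV (\<le>) x 0 \<longrightarrow>
          (\<lambda>n. \<phi> (x n)) \<longlonglongrightarrow> 0)) \<and>
      (\<phi> \<in> uo_dual \<longleftrightarrow>
        (\<forall>x :: nat \<Rightarrow> 'a. norm_bounded_net UNIV x \<longrightarrow> disjoint_sequence x \<longrightarrow>
          (\<lambda>n. \<phi> (x n)) \<longlonglongrightarrow> 0)) \<and>
      (\<phi> \<in> uo_dual \<longleftrightarrow>
        (\<forall>\<psi> :: nat \<Rightarrow> 'a \<Rightarrow> real.
          (\<forall>n. \<psi> n \<in> functional_interval order_cont_dual (\<lambda>_. 0) (functional_abs order_cont_dual \<phi>)) \<longrightarrow>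
          disjoint_functional_sequence order_cont_dual \<psi> \<longrightarrow>
          (\<lambda>n. onorm (\<psi> n)) \<longlonglongrightarrow> 0)))"
proof -
  define uo_seq where "uo_seq \<phi> \<longleftrightarrow> (\<forall>x :: nat \<Rightarrow> 'a. norm_bounded_net UNIV x \<longrightarrow>
    uo_converges UNIV (\<le>) x 0 \<longrightarrow> (\<lambda>n. \<phi> (x n)) \<longlonglongrightarrow> 0)" for \<phi> :: "'a \<Rightarrow> real"
  define disj_seq where "disj_seq \<phi> \<longleftrightarrow> (\<forall>x :: nat \<Rightarrow> 'a. norm_bounded_net UNIV x \<longrightarrow>
    disjoint_sequence x \<longrightarrow> (\<lambda>n. \<phi> (x n)) \<longlonglongrightarrow> 0)" for \<phi> :: "'a \<Rightarrow> real"
  define disj_functionals where "disj_functionals \<phi> \<longleftrightarrow> (\<forall>\<psi> :: nat \<Rightarrow> 'a \<Rightarrow> real.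
    (\<forall>n. \<psi> n \<in> functional_interval order_cont_dual (\<lambda>_. 0) (functional_abs order_cont_dual \<phi>)) \<longrightarrow>
    disjoint_functional_sequence order_cont_dual \<psi> \<longrightarrow> (\<lambda>n. onorm (\<psi> n)) \<longlonglongrightarrow> 0)" for \<phi> :: "'a \<Rightarrow> real"
  have uo_seq: "uo_seq \<phi>" if "\<phi> \<in> uo_dual" for \<phi>
    unfolding uo_seq_def
    using uo_dualD[OF that directed_set_nat] by (simp add: net_filter_nat)
  have disj_seq: "disj_seq \<phi>" if "uo_seq \<phi>" for \<phi>
    using that disjoint_sequence_uo_null unfolding uo_seq_def disj_seq_def by blast
  have small: "\<exists>u\<ge>0. \<forall>x\<ge>0. norm x \<le> M \<longrightarrow> functional_abs order_cont_dual \<phi> (pprt (x - u)) < e"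
    if \<phi>: "\<phi> \<in> order_cont_dual" "disj_seq \<phi>" and "0 < e" for \<phi> e M
  proof (rule positive_functional_tail_small[OF functional_abs_positive[OF \<phi>(1)] \<open>0 < e\<close>])
    fix u :: "nat \<Rightarrow> 'a" assume u: "\<And>n. 0 \<le> u n" "norm_bounded_net UNIV u" "disjoint_sequence u"
    show "(\<lambda>n. functional_abs order_cont_dual \<phi> (u n)) \<longlonglongrightarrow> 0"
    proof (rule functional_abs_disjoint_null[OF \<phi>(1) _ u])
      show "(\<lambda>n. \<phi> (x n)) \<longlonglongrightarrow> 0" if "norm_bounded_net UNIV x" "disjoint_sequence x" for x
        using \<phi>(2) that unfolding disj_seq_def by blast
    qed
  qed
  have uo_dual: "\<phi> \<in> uo_dual" if "\<phi> \<in> order_cont_dual" "disj_seq \<phi>" for \<phi>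
    using that by (intro uo_dualI_tail_small small)
  have disj_functionals: "disj_functionals \<phi>" if \<phi>: "\<phi> \<in> order_cont_dual" "disj_seq \<phi>" for \<phi>
    unfolding disj_functionals_def
  proof (intro allI impI)
    fix \<psi> :: "nat \<Rightarrow> 'a \<Rightarrow> real"
    assume \<psi>: "\<forall>n. \<psi> n \<in> functional_interval order_cont_dual (\<lambda>_. 0) (functional_abs order_cont_dual \<phi>)"
      "disjoint_functional_sequence order_cont_dual \<psi>"
    have "functional_le (\<lambda>_. 0) (functional_abs order_cont_dual \<phi>)"
      using positive_functional_nonneg[OF functional_abs_positive[OF \<phi>(1)]] by (simp add: functional_le_def)
    then show "(\<lambda>n. onorm (\<psi> n)) \<longlonglongrightarrow> 0"
      using \<psi> small[OF \<phi>]
      by (intro onorm_null_if_tail_small[OF functional_abs_in_order_cont_dual[OF \<phi>(1)]]) auto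
  qed
  have disj_seq': "disj_seq \<phi>" if "\<phi> \<in> order_cont_dual" "disj_functionals \<phi>" for \<phi>
    using that(2) disjoint_null_if_functionals_null[OF that(1)]
    unfolding disj_functionals_def disj_seq_def by blast
  \<comment> \<open>Membership in \<open>uo_dual\<close> implies \<open>uo_seq\<close>, this implies
    \<open>disj_seq\<close>, and this leads back to \<open>uo_dual\<close>;
    \<open>disj_functionals\<close> is tied to \<open>disj_seq\<close> in both directions.\<close>
  have equiv: "(\<phi> \<in> uo_dual \<longleftrightarrow> uo_seq \<phi>) \<and> (\<phi> \<in> uo_dual \<longleftrightarrow> disj_seq \<phi>) \<and>
      (\<phi> \<in> uo_dual \<longleftrightarrow> disj_functionals \<phi>)" if "\<phi> \<in> order_cont_dual" for \<phi>
    using that uo_seq disj_seq uo_dual disj_functionals disj_seq' by blast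
  \<comment> \<open>The equivalences concern order continuous functionals only, so the inclusion of
    the uo-dual in the order continuous dual has to be added.\<close>
  moreover have "uo_dual = order_cont_part (order_cont_dual :: ('a \<Rightarrow> real) set)"
    using equiv uo_dual_subset_order_cont_dual
    unfolding order_cont_part_def disj_functionals_def[symmetric] by blast
  ultimately show ?thesis
    unfolding uo_seq_def disj_seq_def disj_functionals_def by blast
qed

end
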